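(* Let $X\subset\mathbb{C}$ be a compact set with empty interior, let $x_0\in X$, and let $2<p<\infty$. Suppose that there is a bounded point derivation (of order $1$) on $R^p(X)$ at $x_0$, denoted by $D_{x_0}^1$. Then, given a function $f$ in $R^p(X)$, there exists a set $E\subset X$ of full area density at $x_0$ such that $$\lim_{x\to x_0,\ x\in E}\left|\frac{f(x)-f(x_0)}{x-x_0}-D_{x_0}^1 f\right|=0 .$$
   Context: $m$ (or $dA$) denotes 2-dimensional Lebesgue (area) measure on $\mathbb{C}$. For compact $X\subset\mathbb{C}$ and $1\le p<\infty$, $R^p(X)$ is the closure in $L^p(X,dA)$ of the rational functions with poles off $X$; $\|\cdot\|_p$ is the norm of $L^p(X,dA)$. For an integer $t\ge 0$, $R^p(X)$ has a bounded point derivation of order $t$ at $x_0\in X$ if there is a constant $C>0$ with $|F^{(t)}(x_0)|\le C\|F\|_p$ for all rational functions $F$ with poles off $X$ (with $F^{(0)}=F$; order $0$ is called a bounded point evaluation). In that case $F\mapsto F^{(t)}(x_0)$ extends uniquely to a bounded linear functional $D_{x_0}^t$ on $R^p(X)$: $D_{x_0}^t f=\lim_{j} f_j^{(t)}(x_0)$ for any sequence $\{f_j\}$ of rational functions with poles off $X$ converging to $f$ in $L^p$. Existence of a bounded point derivation of order $t$ at $x_0$ implies existence of those of all orders $0\le m\le t$ at $x_0$. A (Lebesgue measurable) set $E\subset\mathbb{C}$ has full area density at $x_0$ if $\lim_{n\to\infty}\frac{m(\Delta_n(x_0)\setminus E)}{m(\Delta_n(x_0))}=0$, where $\Delta_n(x_0)$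 is the disc in $\mathbb{C}$ centered at $x_0$ of radius $1/n$. Convention on values: an element $f\in R^p(X)$ is an $L^p$ class; $f(x_0)$ means $D_{x_0}^0 f$, and for $x\ne x_0$, $f(x)$ is the value of a fixed representative of $f$ (the set $E$ may depend on $f$ and the representative). The limit is over $x\in E$, $x\neq x_0$. *)

theory Defs
  imports "HOL-Analysis.Analysis" "HOL-Computational_Algebra.Polynomial"
begin

definition rational_off :: "complex set \<Rightarrow> (complex \<Rightarrow> complex) set" where
  "rational_off X =
     {\<lambda>z. poly P z / poly Q z | P Q. Q \<noteq> 0 \<and> (\<forall>z\<in>X. poly Q z \<noteq> 0)}"

definition Lp_norm :: "real \<Rightarrow> complex set \<Rightarrow> (complex \<Rightarrow> complex) \<Rightarrow> real" where
  "Lp_norm p X f = (\<integral>z. norm (f z) powr p \<partial>(lebesgue_on X)) powr (1 / p)"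

(* Elements of L^p(X) are represented by functions; only their values on X matter. *)
definition Lp_space :: "real \<Rightarrow> complex set \<Rightarrow> (complex \<Rightarrow> complex) set" where
  "Lp_space p X = {f \<in> borel_measurable (lebesgue_on X).
     integrable (lebesgue_on X) (\<lambda>z. norm (f z) powr p)}"

definition Rp :: "real \<Rightarrow> complex set \<Rightarrow> (complex \<Rightarrow> complex) set" where
  "Rp p X = {f \<in> Lp_space p X.
     \<forall>\<epsilon>>0. \<exists>F\<in>rational_off X. Lp_norm p X (\<lambda>z. F z - f z) < \<epsilon>}"

definition has_bounded_point_derivation ::
    "nat \<Rightarrow> real \<Rightarrow> complex set \<Rightarrow> complex \<Rightarrow> bool" where
  "has_bounded_point_derivation t p X x0 \<longleftrightarrow>
     (\<exists>C>0. \<forall>F\<in>rational_off X. norm ((deriv ^^ t) F x0) \<le> C * Lp_norm p X F)"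

(* The extension by continuity of F \<mapsto> F^(t)(x0) to R^p(X). It is meaningful only if R^p(X) has a
   bounded point derivation of order t at x0 and f is in R^p(X); the limit then exists and
   does not depend on the approximating sequence. *)
definition point_derivation ::
    "nat \<Rightarrow> real \<Rightarrow> complex set \<Rightarrow> complex \<Rightarrow> (complex \<Rightarrow> complex) \<Rightarrow> complex" where
  "point_derivation t p X x0 f =
     (THE v. \<forall>F. (\<forall>j. F j \<in> rational_off X) \<and>
                 (\<lambda>j::nat. Lp_norm p X (\<lambda>z. F j z - f z)) \<longlonglongrightarrow> 0 \<longrightarrow>
                 (\<lambda>j. (deriv ^^ t) (F j) x0) \<longlonglongrightarrow> v)"

definition full_area_density :: "complex set \<Rightarrow> complex \<Rightarrow> bool" where
  "full_area_density E x0 \<longleftrightarrow> E \<in> sets lebesgue \<and>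
     (\<lambda>n::nat. measure lebesgue (ball x0 (1 / real n) - E) /
               measure lebesgue (ball x0 (1 / real n))) \<longlonglongrightarrow> 0"

end

theory Submission
  imports Defs
begin

text \<open>The derivation is represented by a kernel: \<open>F'(x0) = \<integral> F k dA\<close> for rational \<open>F\<close>, with \<open>k \<in> L\<^sup>q(X)\<close>. By
  the product rule \<open>(z - x0) k\<close> represents the evaluation at \<open>x0\<close>, and \<open>(z - x0)\<^sup>2 k\<close> annihilates the rational
  functions. Testing the latter on the difference quotient \<open>(F(z) - F(x)) / (z - x)\<close>, and writing
  \<open>(z - x0)\<^sup>2 / (z - x) = (z - x0) + (x - x0) + (x - x0)\<^sup>2 / (z - x)\<close>, one finds for \<open>x \<in> X\<close>

  \<open>F(x) (1 + (x - x0)\<^sup>2 \<kappa>(x)) = F(x0) + (x - x0) F'(x0) + (x - x0)\<^sup>2 \<phi>(x)\<close>,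

  where \<open>\<kappa>\<close> and \<open>\<phi>\<close> are the Cauchy integrals of \<open>k\<close> and \<open>F k\<close>
  (\<open>Cauchy_transform_identity\<close>). Approximation extends this to every \<open>f \<in> R\<^sup>p(X)\<close> for almost every \<open>x\<close>, with
  the point derivations of \<open>f\<close> in place of \<open>F(x0)\<close> and \<open>F'(x0)\<close> (\<open>Cauchy_transform_identity_Rp\<close>).

  So the difference quotient of \<open>f\<close> tends to the point derivation wherever \<open>(x - x0) \<kappa>(x)\<close> and
  \<open>(x - x0) \<phi>(x)\<close> tend to \<open>0\<close>. Both are at most \<open>norm (x - x0)\<close> times the potential
  \<open>\<integral> h(z) / norm (z - x) dA(z)\<close> of an integrable \<open>h\<close>. The average of this product over the disc of radius \<open>r\<close>
  around \<open>x0\<close> tends to \<open>0\<close> with \<open>r\<close> (\<open>riesz_potential_average_tendsto_0\<close>), and therefore the product tends to \<open>0\<close>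
  along a set of full area density (\<open>full_density_limit_of_average_tendsto_0\<close>). Near \<open>x0\<close> this set lies
  in \<open>X\<close> up to a null set, because off \<open>X\<close> the same computation with \<open>1 / (z - x)\<close> gives
  \<open>(x - x0)\<^sup>2 \<kappa>(x) = -1\<close>.

  The kernel \<open>k\<close> is obtained from an extremal problem in \<open>L\<^sup>p\<close>, which has a solution because \<open>L\<^sup>p\<close> is uniformly
  convex (\<open>integral_representation_of_bounded_functional\<close>).\<close>

section \<open>Convexity of powers of the norm\<close>

text \<open>Young's inequality without conjugate exponents. In this form it is the tangent inequality of the
  convex function \<open>\<lambda>a. a powr s\<close> at \<open>b\<close>.\<close>

lemma young_powr:
  fixes s a b :: real
  assumes "1 < s" "0 \<le> a" "0 \<le> b"
  shows "s * (b powr (s - 1) * a) \<le> (s - 1) * b powr s + a powr s"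
proof -
  define q where "q = s / (s - 1)"
  have q: "q > 1" "1 / s + 1 / q = 1" "(s - 1) * q = s" "s / q = s - 1"
    using assms by (auto simp: q_def field_simps)
  have "a * b powr (s - 1) \<le> a powr s / s + (b powr (s - 1)) powr q / q"
    using assms q by (intro Youngs_inequality) auto
  then have "s * (a * b powr (s - 1)) \<le> s * (a powr s / s + b powr s / q)"
    using assms q by (intro mult_left_mono) (auto simp: powr_powr)
  also have "\<dots> = a powr s + (s / q) * b powr s"
    using assms by (simp add: field_simps)
  finally show ?thesis
    using q by (simp add: mult_ac)
qed

lemma powr_superadditive:
  fixes s u v :: real
  assumes "1 \<le> s" "0 \<le> u" "0 \<le> v"
  shows "u powr s + v powr s \<le> (u + v) powr s"
proof (cases "u + v = 0")
  case True
  then have "u = 0" "v = 0" using assms by auto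
  then show ?thesis by simp
next
  case False
  have *: "x powr s \<le> x * (u + v) powr (s - 1)" if "0 \<le> x" "x \<le> u + v" for x
  proof (cases "x = 0")
    case False
    have "x powr s = x * x powr (s - 1)"
      using that False powr_mult_base[of x "s - 1"] by simp
    also have "\<dots> \<le> x * (u + v) powr (s - 1)"
      using that assms by (intro mult_left_mono powr_mono2) auto
    finally show ?thesis .
  qed auto
  have "u powr s + v powr s \<le> (u + v) * (u + v) powr (s - 1)"
    using *[of u] *[of v] assms by (simp add: algebra_simps)
  also have "\<dots> = (u + v) powr s"
    using assms powr_mult_base[of "u + v" "s - 1"] by simp
  finally show ?thesis .
qed

text \<open>Convexity of \<open>\<lambda>a. a powr s\<close> at the midpoint: add the tangent inequalities at \<open>(a + b) / 2\<close>.\<close>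

lemma powr_add_le:
  fixes s a b :: real
  assumes "1 < s" "0 \<le> a" "0 \<le> b"
  shows "(a + b) powr s \<le> 2 powr (s - 1) * (a powr s + b powr s)"
proof -
  define m where "m = (a + b) / 2"
  have m: "0 \<le> m" "a + b = 2 * m" using assms by (auto simp: m_def)
  have "s * (m powr (s - 1) * a) + s * (m powr (s - 1) * b)
          \<le> 2 * ((s - 1) * m powr s) + (a powr s + b powr s)"
    using young_powr[of s a m] young_powr[of s b m] assms m by linarith
  moreover have "s * (m powr (s - 1) * a) + s * (m powr (s - 1) * b) = 2 * s * m powr s"
  proof -
    have "s * (m powr (s - 1) * a) + s * (m powr (s - 1) * b) = s * (m powr (s - 1) * (a + b))"
      by (simp add: algebra_simps)
    also have "\<dots> = 2 * s * (m * m powr (s - 1))" using m by simp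
    also have "m * m powr (s - 1) = m powr s"
      using m powr_mult_base[of m "s - 1"] by simp
    finally show ?thesis .
  qed
  ultimately have "2 * m powr s \<le> a powr s + b powr s"
    by (simp add: algebra_simps)
  then have "2 powr (s - 1) * (2 * m powr s) \<le> 2 powr (s - 1) * (a powr s + b powr s)"
    by (intro mult_left_mono) auto
  moreover have "(a + b) powr s = 2 powr (s - 1) * (2 * m powr s)"
    using m powr_mult_base[of 2 "s - 1"] by (simp add: powr_mult mult_ac)
  ultimately show ?thesis by simp
qed

text \<open>Clarkson's inequality, pointwise. The exponent \<open>p / 2 > 1\<close> is applied to the two sides of the
  parallelogram law, superadditivity bounding the left side and convexity the right one. Integrated,
  it says that \<open>L\<^sup>p\<close> is uniformly convex.\<close>

lemma clarkson_inequality: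
  fixes a b :: "'a::real_inner"
  assumes "2 < p"
  shows "norm (a + b) powr p + norm (a - b) powr p
           \<le> 2 powr (p - 1) * (norm a powr p + norm b powr p)"
proof -
  define s where "s = p / 2"
  have s: "1 < s" "p = 2 * s" using assms by (auto simp: s_def)
  have sq: "norm x powr p = ((norm x)\<^sup>2) powr s" for x :: 'a
    using s by (simp add: powr_powr flip: powr_numeral)
  have "norm (a + b) powr p + norm (a - b) powr p
          \<le> ((norm (a + b))\<^sup>2 + (norm (a - b))\<^sup>2) powr s"
    unfolding sq using s by (intro powr_superadditive) auto
  also have "(norm (a + b))\<^sup>2 + (norm (a - b))\<^sup>2 = 2 * ((norm a)\<^sup>2 + (norm b)\<^sup>2)"
    by (simp add: power2_norm_eq_inner algebra_simps inner_commute)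
  also have "\<dots> powr s = 2 powr s * ((norm a)\<^sup>2 + (norm b)\<^sup>2) powr s"
    by (rule powr_mult)
  also have "\<dots> \<le> 2 powr s * (2 powr (s - 1) * (((norm a)\<^sup>2) powr s + ((norm b)\<^sup>2) powr s))"
    using s by (intro mult_left_mono powr_add_le) auto
  also have "\<dots> = 2 powr (p - 1) * (norm a powr p + norm b powr p)"
    unfolding sq using s(2) by (simp flip: powr_add mult.assoc)
  finally show ?thesis .
qed

text \<open>Up to the factor \<open>p\<close>, this is the gradient of \<open>\<lambda>c. norm c powr p\<close>, written as a complex linear
  form; it carries \<open>L\<^sup>p\<close> into the conjugate space \<open>L\<^sup>q\<close>.\<close>

definition duality_map :: "real \<Rightarrow> complex \<Rightarrow> complex" where
  "duality_map p c = of_real (norm c powr (p - 2)) * cnj c"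

lemma norm_duality_map: "norm (duality_map p c) = norm c powr (p - 1)"
proof (cases "c = 0")
  case False
  then show ?thesis using powr_mult_base[of "norm c" "p - 2"]
    by (simp add: duality_map_def norm_mult mult.commute)
qed (simp add: duality_map_def)

lemma duality_map_mult_self: "duality_map p c * c = of_real (norm c powr p)"
proof (cases "c = 0")
  case False
  have "cnj c * c = of_real (norm c ^ 2)"
    by (metis complex_norm_square mult.commute of_real_power)
  then have "duality_map p c * c = of_real (norm c powr (p - 2) * norm c powr 2)"
    using False by (simp add: duality_map_def mult.assoc flip: powr_numeral)
  also have "\<dots> = of_real (norm c powr p)"
    by (simp only: powr_add[symmetric]) simp
  finally show ?thesis .
qed (simp add: duality_map_def)

lemma continuous_on_duality_map:
  assumes "2 < p"
  shows "continuous_on UNIV (duality_map p)"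
proof -
  have "isCont (duality_map p) c" for c
    unfolding duality_map_def isCont_def
    by (intro tendsto_intros tendsto_powr') (use assms in auto)
  then show ?thesis by (simp add: continuous_at_imp_continuous_on)
qed

lemma measurable_duality_map [measurable]:
  assumes "2 < p"
  shows "duality_map p \<in> borel_measurable borel"
  using continuous_on_duality_map[OF assms] by (rule borel_measurable_continuous_onI)

text \<open>The tangent inequality for the convex function \<open>\<lambda>c. norm c powr p\<close>. Being exact at every point,
  it makes it possible to derive the variational condition for a minimal element without
  differentiating under the integral sign.\<close>

lemma norm_powr_tangent:
  assumes "2 < p"
  shows "norm c powr p - norm a powr p \<le> p * Re (duality_map p c * (c - a))"
proof -
  have "Re (duality_map p c * a) \<le> norm c powr (p - 1) * norm a"
    using complex_Re_le_cmod[of "duality_map p c * a"] by (simp add: norm_mult norm_duality_map)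
  then have "p * Re (duality_map p c * a) \<le> p * (norm c powr (p - 1) * norm a)"
    using assms by (intro mult_left_mono) auto
  also have "\<dots> \<le> (p - 1) * norm c powr p + norm a powr p"
    using assms by (intro young_powr) auto
  finally show ?thesis
    unfolding right_diff_distrib duality_map_mult_self minus_complex.sel Re_complex_of_real
    by (simp only: algebra_simps)
qed

section \<open>Series of integrable functions and Hoelder's inequality\<close>

lemma AE_summable_of_summable_integral:
  fixes T :: "nat \<Rightarrow> 'a \<Rightarrow> real"
  assumes int: "\<And>n. integrable M (T n)" and nn: "\<And>n x. 0 \<le> T n x"
    and sum: "summable (\<lambda>n. \<integral>x. T n x \<partial>M)"
  shows "AE x in M. summable (\<lambda>n. T n x)"
proof -
  have [measurable]: "T n \<in> borel_measurable M" for n using int by auto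
  have "(\<integral>\<^sup>+x. (\<Sum>n. ennreal (T n x)) \<partial>M) = (\<Sum>n. \<integral>\<^sup>+x. ennreal (T n x) \<partial>M)"
    by (rule nn_integral_suminf) auto
  also have "\<dots> = (\<Sum>n. ennreal (\<integral>x. T n x \<partial>M))"
    using int nn by (simp add: nn_integral_eq_integral)
  also have "\<dots> = ennreal (\<Sum>n. \<integral>x. T n x \<partial>M)"
    using nn sum by (intro suminf_ennreal2) (auto intro: integral_nonneg_AE)
  finally have "(\<integral>\<^sup>+x. (\<Sum>n. ennreal (T n x)) \<partial>M) \<noteq> \<infinity>" by simp
  then have "AE x in M. (\<Sum>n. ennreal (T n x)) \<noteq> \<infinity>"
    by (intro nn_integral_PInf_AE) auto
  then show ?thesis
    by eventually_elim (use nn in \<open>auto intro!: summable_suminf_not_top\<close>)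
qed

lemma Holder_integral_inequality:
  fixes u k :: "'a \<Rightarrow> 'b::{real_normed_div_algebra, second_countable_topology}"
  assumes pq: "1 < p" "1 < q" "1 / p + 1 / q = (1::real)"
    and meas [measurable]: "u \<in> borel_measurable M" "k \<in> borel_measurable M"
    and u: "integrable M (\<lambda>z. norm (u z) powr p)"
    and k: "integrable M (\<lambda>z. norm (k z) powr q)"
  shows "integrable M (\<lambda>z. norm (u z) * norm (k z))"
    and "(\<integral>z. norm (u z) * norm (k z) \<partial>M)
          \<le> (\<integral>z. norm (u z) powr p \<partial>M) powr (1 / p) * (\<integral>z. norm (k z) powr q \<partial>M) powr (1 / q)"
proof -
  let ?U = "\<integral>z. norm (u z) powr p \<partial>M" and ?K = "\<integral>z. norm (k z) powr q \<partial>M"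
  show int: "integrable M (\<lambda>z. norm (u z) * norm (k z))"
  proof (rule Bochner_Integration.integrable_bound)
    show "integrable M (\<lambda>z. norm (u z) powr p / p + norm (k z) powr q / q)"
      using u k by auto
    show "AE z in M. norm (norm (u z) * norm (k z))
            \<le> norm (norm (u z) powr p / p + norm (k z) powr q / q)"
      using pq by (auto intro!: AE_I2 order_trans[OF Youngs_inequality[of p q]] abs_ge_self)
  qed simp
  show "(\<integral>z. norm (u z) * norm (k z) \<partial>M) \<le> ?U powr (1 / p) * ?K powr (1 / q)"
  proof (cases "?U = 0 \<or> ?K = 0")
    case True
    have "AE z in M. norm (u z) * norm (k z) = 0"
      using True
    proof
      assume "?U = 0"
      then have "AE z in M. norm (u z) powr p = 0"
        using u by (subst (asm) integral_nonneg_eq_0_iff_AE) auto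
      then show ?thesis by eventually_elim auto
    next
      assume "?K = 0"
      then have "AE z in M. norm (k z) powr q = 0"
        using k by (subst (asm) integral_nonneg_eq_0_iff_AE) auto
      then show ?thesis by eventually_elim auto
    qed
    then have "(\<integral>z. norm (u z) * norm (k z) \<partial>M) = 0" by (rule integral_eq_zero_AE)
    then show ?thesis by simp
  next
    case False
    moreover have "0 \<le> ?U" "0 \<le> ?K" by (auto intro: integral_nonneg_AE)
    ultimately have pos: "0 < ?U" "0 < ?K" by (metis less_le)+
    define \<alpha> \<beta> where "\<alpha> = ?U powr (1 / p)" and "\<beta> = ?K powr (1 / q)"
    have ab: "0 < \<alpha>" "0 < \<beta>" "\<alpha> powr p = ?U" "\<beta> powr q = ?K"
      using pos pq by (auto simp: \<alpha>_def \<beta>_def powr_powr)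
    have pt: "norm (u z) * norm (k z) \<le> \<alpha> * \<beta> * (norm (u z) powr p / ?U / p + norm (k z) powr q / ?K / q)" for z
    proof -
      have "(norm (u z) / \<alpha>) * (norm (k z) / \<beta>)
              \<le> (norm (u z) / \<alpha>) powr p / p + (norm (k z) / \<beta>) powr q / q"
        using pq ab by (intro Youngs_inequality) auto
      also have "\<dots> = norm (u z) powr p / ?U / p + norm (k z) powr q / ?K / q"
        using ab by (simp add: powr_divide)
      finally have "\<alpha> * \<beta> * ((norm (u z) / \<alpha>) * (norm (k z) / \<beta>))
              \<le> \<alpha> * \<beta> * (norm (u z) powr p / ?U / p + norm (k z) powr q / ?K / q)"
        using ab by (intro mult_left_mono) auto
      then show ?thesis using ab by simp
    qed
    have "(\<integral>z. norm (u z) * norm (k z) \<partial>M)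
            \<le> (\<integral>z. \<alpha> * \<beta> * (norm (u z) powr p / ?U / p + norm (k z) powr q / ?K / q) \<partial>M)"
      using int u k pt by (intro integral_mono) auto
    also have "\<dots> = \<alpha> * \<beta> * (?U / ?U / p + ?K / ?K / q)"
      using u k by simp
    also have "\<dots> = \<alpha> * \<beta>" using pos pq by simp
    finally show ?thesis by (simp add: \<alpha>_def \<beta>_def)
  qed
qed

section \<open>Bounded functionals and extremal functions\<close>

text \<open>A functional on a space \<open>V\<close> of bounded functions that is continuous for the \<open>L\<^sup>p\<close> norm is given by a
  kernel in \<open>L\<^sup>q\<close>. The kernel comes from an extremal problem: minimise the norm over the affine space
  \<open>{F \<in> V. L F = 1}\<close>. By Clarkson's inequality minimising sequences are Cauchy, and the limit \<open>g\<close> satisfies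
  the Euler equation: \<open>duality_map p \<circ> g\<close> annihilates the null space of \<open>L\<close>. Hence it represents a
  multiple of \<open>L\<close>, and the multiple is \<open>\<integral> norm g powr p > 0\<close>, because the minimum is positive for a
  bounded functional.\<close>

lemma (in finite_measure) integral_representation_of_bounded_functional:
  fixes V :: "('a \<Rightarrow> complex) set" and L :: "('a \<Rightarrow> complex) \<Rightarrow> complex"
    and p C :: real
  assumes p: "2 < p"
    and V_meas: "\<And>F. F \<in> V \<Longrightarrow> F \<in> borel_measurable M"
    and V_bdd: "\<And>F. F \<in> V \<Longrightarrow> \<exists>B. \<forall>z\<in>space M. norm (F z) \<le> B"
    and V_add: "\<And>F G. F \<in> V \<Longrightarrow> G \<in> V \<Longrightarrow> (\<lambda>z. F z + G z) \<in> V"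
    and V_scale: "\<And>F c. F \<in> V \<Longrightarrow> (\<lambda>z. c * F z) \<in> V"
    and L_add: "\<And>F G. F \<in> V \<Longrightarrow> G \<in> V \<Longrightarrow> L (\<lambda>z. F z + G z) = L F + L G"
    and L_scale: "\<And>F c. F \<in> V \<Longrightarrow> L (\<lambda>z. c * F z) = c * L F"
    and L_bdd: "\<And>F. F \<in> V \<Longrightarrow> norm (L F) \<le> C * (\<integral>z. norm (F z) powr p \<partial>M) powr (1 / p)"
    and L_nonzero: "\<exists>F\<in>V. L F \<noteq> 0"
  shows "\<exists>k \<in> borel_measurable M. integrable M (\<lambda>z. norm (k z) powr (p / (p - 1))) \<and>
           (\<forall>F\<in>V. L F = (\<integral>z. F z * k z \<partial>M))"
proof -
  define N where "N F = (\<integral>z. norm (F z) powr p \<partial>M)" for F :: "'a \<Rightarrow> complex"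
  define S where "S = {F \<in> V. L F = 1}"
  define d where "d = (INF F\<in>S. N F)"
  have N_nonneg: "0 \<le> N F" for F
    unfolding N_def by (intro integral_nonneg_AE) auto
  have V_int: "integrable M (\<lambda>z. norm (F z) powr p)" if F: "F \<in> V" for F
  proof -
    obtain B where B: "\<forall>z\<in>space M. norm (F z) \<le> B" using V_bdd[OF F] by blast
    show ?thesis
    proof (rule integrable_const_bound[where B="\<bar>B\<bar> powr p"])
      show "AE z in M. norm (norm (F z) powr p) \<le> \<bar>B\<bar> powr p"
        using B p by (intro AE_I2) (auto intro!: powr_mono2 order_trans[OF _ abs_ge_self])
    qed (use V_meas[OF F] in measurable)
  qed
  have V_diff: "(\<lambda>z. F z - G z) \<in> V" "L (\<lambda>z. F z - G z) = L F - L G"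
    if "F \<in> V" "G \<in> V" for F G
    using V_add[OF that(1) V_scale[OF that(2), of "-1"]] L_add[OF that(1) V_scale[OF that(2), of "-1"]]
      L_scale[OF that(2), of "-1"] by auto
  obtain E0 where E0: "E0 \<in> S"
  proof -
    obtain F where "F \<in> V" "L F \<noteq> 0" using L_nonzero by blast
    then have "(\<lambda>z. (1 / L F) * F z) \<in> S"
      unfolding S_def using V_scale[of F "1 / L F"] L_scale[of F "1 / L F"] by auto
    then show ?thesis by (rule that)
  qed
  have C: "1 \<le> C * N F powr (1 / p)" if "F \<in> S" for F
    using L_bdd[of F] that by (auto simp: S_def N_def)
  have Cpos: "0 < C"
    using C[OF E0] by (smt (verit) mult_nonneg_nonneg mult_nonpos_nonneg powr_ge_zero)
  have low: "(1 / C) powr p \<le> N F" if "F \<in> S" for F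
  proof -
    have "1 / C \<le> N F powr (1 / p)" using C[OF that] Cpos by (simp add: field_simps)
    then have "(1 / C) powr p \<le> (N F powr (1 / p)) powr p"
      using Cpos p by (intro powr_mono2) auto
    then show ?thesis using N_nonneg[of F] p by (simp add: powr_powr)
  qed
  have bdd: "bdd_below (N ` S)" by (rule bdd_belowI2[of _ 0]) (rule N_nonneg)
  have d_le: "d \<le> N F" if "F \<in> S" for F
    unfolding d_def by (rule cINF_lower[OF bdd that])
  have d_pos: "0 < d"
  proof -
    have "(1 / C) powr p \<le> d" unfolding d_def using E0 low by (intro cINF_greatest) auto
    then show ?thesis using Cpos by (smt (verit) powr_gt_zero divide_pos_pos)
  qed

  \<comment> \<open>The excess \<open>e n\<close> decays so fast that the differences of consecutive terms stay summable in \<open>L\<^sup>p\<close>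
    even with the weights \<open>2 ^ n\<close>. This yields an envelope of the whole sequence, and with it every
    passage to the limit below is an instance of dominated convergence.\<close>
  define e :: "nat \<Rightarrow> real" where "e n = (1/4) ^ n * (1/2) powr (real n * p)" for n
  have "\<exists>F\<in>S. N F < d + e n" for n
  proof -
    have "d < d + e n" by (simp add: e_def)
    then show ?thesis unfolding d_def using E0 bdd cINF_less_iff[of S N] by blast
  qed
  then obtain F where F: "\<And>n. F n \<in> S" "\<And>n. N (F n) < d + e n" by metis
  have FV: "F n \<in> V" "L (F n) = 1" for n using F(1)[of n] by (auto simp: S_def)
  have Fm [measurable]: "F n \<in> borel_measurable M" for n using FV V_meas by blast
  define u where "u n z = F (Suc n) z - F n z" for n z
  have uV: "u n \<in> V" for n unfolding u_def using V_diff FV by blast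
  have Nu: "N (u n) \<le> 2 powr p * e n" for n
  proof -
    \<comment> \<open>The midpoint of two competitors is again a competitor, so its norm is at least the minimum.\<close>
    have mid: "d \<le> N (\<lambda>z. (1/2) * (F (Suc n) z + F n z))"
      using V_scale[OF V_add[OF FV(1) FV(1)], of "1/2" "Suc n" n]
        L_scale[OF V_add[OF FV(1) FV(1)], of "1/2" "Suc n" n] L_add[OF FV(1) FV(1), of "Suc n" n] FV(2)
      by (intro d_le) (simp add: S_def)
    have mid': "N (\<lambda>z. F (Suc n) z + F n z) = 2 powr p * N (\<lambda>z. (1/2) * (F (Suc n) z + F n z))"
    proof -
      have "norm (F (Suc n) z + F n z) powr p = 2 powr p * norm ((1/2) * (F (Suc n) z + F n z)) powr p" for z
        by (subst powr_mult[symmetric]) (auto simp: norm_mult norm_divide)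
      then show ?thesis unfolding N_def by simp
    qed
    have "N (\<lambda>z. F (Suc n) z + F n z) + N (u n) =
       (\<integral>z. norm (F (Suc n) z + F n z) powr p + norm (F (Suc n) z - F n z) powr p \<partial>M)"
      unfolding N_def using V_int[OF V_add[OF FV(1) FV(1)]] V_int[OF uV] unfolding u_def
      by (intro Bochner_Integration.integral_add[symmetric])
    also have "\<dots> \<le> (\<integral>z. 2 powr (p - 1) * (norm (F (Suc n) z) powr p + norm (F n z) powr p) \<partial>M)"
    proof (rule integral_mono)
      show "integrable M (\<lambda>z. norm (F (Suc n) z + F n z) powr p + norm (F (Suc n) z - F n z) powr p)"
        using V_int[OF V_add[OF FV(1) FV(1)]] V_int[OF uV] unfolding u_def by auto
      show "integrable M (\<lambda>z. 2 powr (p - 1) * (norm (F (Suc n) z) powr p + norm (F n z) powr p))"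
        using V_int[OF FV(1)] by auto
    qed (rule clarkson_inequality[OF p])
    also have "\<dots> = 2 powr (p - 1) * (N (F (Suc n)) + N (F n))"
      unfolding N_def using V_int[OF FV(1)] by simp
    also have "\<dots> \<le> 2 powr (p - 1) * ((d + e n) + (d + e n))"
    proof -
      have "e (Suc n) \<le> e n"
        unfolding e_def using p by (intro mult_mono powr_mono' power_decreasing) auto
      then show ?thesis using F(2)[of n] F(2)[of "Suc n"] by (intro mult_left_mono) auto
    qed
    also have "\<dots> = 2 powr p * d + 2 powr p * e n"
      using powr_mult_base[of 2 "p - 1"] by (simp add: algebra_simps)
    finally show ?thesis using mid unfolding mid'
      by (smt (verit) mult_left_mono powr_ge_zero)
  qed

  define T where "T n z = (2 ^ n * norm (u n z)) powr p" for n z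
  have T_eq: "T n z = 2 powr (real n * p) * norm (u n z) powr p" for n z
    by (simp add: T_def powr_mult powr_powr flip: powr_realpow)
  have T_int: "integrable M (T n)" for n
    unfolding T_eq using V_int[OF uV] by auto
  have T_nonneg: "0 \<le> T n z" for n z by (simp add: T_def)
  have T_sum: "summable (\<lambda>n. \<integral>z. T n z \<partial>M)"
  proof (rule summable_comparison_test')
    show "summable (\<lambda>n. 2 powr p * (1/4) ^ n)" by (intro summable_mult summable_geometric) auto
    show "norm (\<integral>z. T n z \<partial>M) \<le> 2 powr p * (1/4) ^ n" for n
    proof -
      have "(\<integral>z. T n z \<partial>M) = 2 powr (real n * p) * N (u n)" unfolding T_eq N_def by simp
      also have "\<dots> \<le> 2 powr (real n * p) * (2 powr p * e n)" by (intro mult_left_mono Nu) auto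
      also have "\<dots> = 2 powr p * (1/4) ^ n * (2 powr (real n * p) * (1/2) powr (real n * p))"
        by (simp add: e_def)
      also have "2 powr (real n * p) * (1/2) powr (real n * p) = 1"
        by (subst powr_mult[symmetric]) auto
      finally show ?thesis
        using T_nonneg by (subst abs_of_nonneg real_norm_def)+ (auto intro: integral_nonneg_AE)
    qed
  qed
  define H where "H z = (\<Sum>n. T n z)" for z
  have H_ae: "AE z in M. summable (\<lambda>n. T n z)"
    by (rule AE_summable_of_summable_integral[OF T_int T_nonneg T_sum])
  have H_int: "integrable M H"
    unfolding H_def by (rule integrable_suminf) (use T_int T_nonneg T_sum H_ae in auto)
  have [measurable]: "H \<in> borel_measurable M" using H_int by auto
  obtain B0 where B0: "\<And>z. z \<in> space M \<Longrightarrow> norm (F 0 z) \<le> B0" "0 \<le> B0"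
    using V_bdd[OF FV(1)[of 0]] by (metis abs_ge_self abs_ge_zero order_trans)
  define B where "B z = B0 + 2 * \<bar>H z\<bar> powr (1 / p)" for z
  have [measurable]: "B \<in> borel_measurable M" unfolding B_def by measurable
  have B_nonneg: "0 \<le> B z" for z using B0 by (simp add: B_def)
  have env: "summable (\<lambda>n. norm (u n z)) \<and> (\<forall>n. norm (F n z) \<le> B z)"
    if s: "summable (\<lambda>n. T n z)" and z: "z \<in> space M" for z
  proof -
    have H0: "0 \<le> H z" unfolding H_def using T_nonneg s by (intro suminf_nonneg) auto
    have ub: "norm (u n z) \<le> H z powr (1/p) * (1/2) ^ n" for n
    proof -
      have "T n z \<le> H z"
        unfolding H_def using sum_le_suminf[OF s, of "{n}"] T_nonneg by auto
      then have "T n z powr (1/p) \<le> H z powr (1/p)"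
        using T_nonneg p by (intro powr_mono2) auto
      then have "2 ^ n * norm (u n z) \<le> H z powr (1/p)"
        unfolding T_def using p by (simp add: powr_powr)
      then show ?thesis by (simp add: field_simps)
    qed
    have geo: "summable (\<lambda>n. H z powr (1/p) * (1/2::real) ^ n)"
      by (intro summable_mult summable_geometric) auto
    have "summable (\<lambda>n. norm (u n z))"
      by (rule summable_comparison_test'[OF geo]) (use ub in auto)
    moreover have "norm (F n z) \<le> B z" for n
    proof -
      have "F n z = F 0 z + (\<Sum>i<n. u i z)"
        unfolding u_def using sum_lessThan_telescope[of "\<lambda>i. F i z" n] by simp
      then have "norm (F n z) \<le> norm (F 0 z) + (\<Sum>i<n. norm (u i z))"
        by (metis norm_triangle_le add_left_mono norm_sum order_refl)
      also have "(\<Sum>i<n. norm (u i z)) \<le> (\<Sum>i<n. H z powr (1/p) * (1/2::real) ^ i)"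
        by (intro sum_mono ub)
      also have "\<dots> \<le> (\<Sum>i. H z powr (1/p) * (1/2::real) ^ i)"
        by (intro sum_le_suminf geo) auto
      also have "\<dots> = 2 * H z powr (1/p)"
        by (subst suminf_mult) (auto simp: suminf_geometric summable_geometric)
      finally show ?thesis using B0(1)[OF z] H0 by (simp add: B_def)
    qed
    ultimately show ?thesis by blast
  qed
  define g where "g z = lim (\<lambda>n. F n z)" for z
  have g_meas [measurable]: "g \<in> borel_measurable M"
    unfolding g_def by (rule borel_measurable_lim_metric) auto
  have ae: "AE z in M. (\<lambda>n. F n z) \<longlonglongrightarrow> g z \<and> (\<forall>n. norm (F n z) \<le> B z) \<and> norm (g z) \<le> B z"
    using H_ae AE_space
  proof eventually_elim
    case (elim z)
    have eq: "(\<lambda>n. F n z) = (\<lambda>n. F 0 z + (\<Sum>i<n. u i z))"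
      unfolding u_def by (rule ext) (simp add: sum_lessThan_telescope[of "\<lambda>i. F i z"])
    have "(\<lambda>n. F 0 z + (\<Sum>i<n. u i z)) \<longlonglongrightarrow> F 0 z + (\<Sum>i. u i z)"
      using env[OF elim] by (intro tendsto_add[OF tendsto_const] summable_LIMSEQ) (blast intro: summable_norm_cancel)
    then have "convergent (\<lambda>n. F 0 z + (\<Sum>i<n. u i z))" by (rule convergentI)
    then have "convergent (\<lambda>n. F n z)" unfolding eq[symmetric] .
    then have lim: "(\<lambda>n. F n z) \<longlonglongrightarrow> g z" by (simp add: g_def convergent_LIMSEQ_iff)
    moreover have "norm (g z) \<le> B z"
      by (rule LIMSEQ_le_const2[OF tendsto_norm[OF lim]]) (use env[OF elim] in auto)
    ultimately show ?case using env[OF elim] by blast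
  qed
  have Bp: "integrable M (\<lambda>z. (B z + c) powr p)" if "0 \<le> c" for c
  proof (rule Bochner_Integration.integrable_bound)
    show "integrable M (\<lambda>z. 2 powr (p-1) * (2 powr p * \<bar>H z\<bar> + (B0 + c) powr p))" using H_int by auto
    have "(B z + c) powr p \<le> 2 powr (p-1) * (2 powr p * \<bar>H z\<bar> + (B0 + c) powr p)" for z
    proof -
      have "(B z + c) powr p = (2 * \<bar>H z\<bar> powr (1 / p) + (B0 + c)) powr p"
        by (simp add: B_def algebra_simps)
      also have "\<dots> \<le> 2 powr (p-1) * ((2 * \<bar>H z\<bar> powr (1 / p)) powr p + (B0 + c) powr p)"
        using p B0 that by (intro powr_add_le) auto
      also have "(2 * \<bar>H z\<bar> powr (1 / p)) powr p = 2 powr p * \<bar>H z\<bar>"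
        using p by (simp add: powr_mult powr_powr)
      finally show ?thesis .
    qed
    then show "AE z in M. norm ((B z + c) powr p)
        \<le> norm (2 powr (p-1) * (2 powr p * \<bar>H z\<bar> + (B0 + c) powr p))"
      by (intro AE_I2) (simp add: abs_of_nonneg)
  qed measurable
  have g_int: "integrable M (\<lambda>z. norm (g z) powr p)"
  proof (rule Bochner_Integration.integrable_bound[OF Bp[of 0]])
    show "AE z in M. norm (norm (g z) powr p) \<le> norm ((B z + 0) powr p)"
      using ae by eventually_elim (use p in \<open>auto intro!: powr_mono2\<close>)
  qed auto
  have lim_N: "(\<lambda>n. N (\<lambda>z. F n z + G z)) \<longlonglongrightarrow> N (\<lambda>z. g z + G z)"
    if G: "G \<in> borel_measurable M" "\<And>z. z \<in> space M \<Longrightarrow> norm (G z) \<le> c" "0 \<le> c" for G c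
    unfolding N_def
  proof (rule integral_dominated_convergence[OF _ _ Bp[OF G(3)]])
    show "AE z in M. (\<lambda>n. norm (F n z + G z) powr p) \<longlonglongrightarrow> norm (g z + G z) powr p"
      using ae by eventually_elim (use p in \<open>auto intro!: tendsto_powr' tendsto_intros\<close>)
    show "AE z in M. norm (norm (F n z + G z) powr p) \<le> (B z + c) powr p" for n
      using ae AE_space
    proof eventually_elim
      case (elim z)
      then have "norm (F n z + G z) \<le> B z + c"
        using G(2)[of z] by (intro norm_triangle_le add_mono) auto
      then show ?case using p by (auto intro!: powr_mono2)
    qed
  qed (use G(1) in measurable)
  have Ng: "N g = d"
  proof -
    have "(\<lambda>n. N (F n)) \<longlonglongrightarrow> N g" using lim_N[of "\<lambda>_. 0" 0] by simp
    moreover have "(\<lambda>n. N (F n)) \<longlonglongrightarrow> d"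
    proof (rule tendsto_sandwich[where f="\<lambda>_. d" and h="\<lambda>n. d + (1/4)^n"])
      show "\<forall>\<^sub>F n in sequentially. d \<le> N (F n)" using d_le F(1) by auto
      have "e n \<le> (1/4)^n" for n
        unfolding e_def using p by (intro mult_left_le) (auto intro: powr_le1)
      then show "\<forall>\<^sub>F n in sequentially. N (F n) \<le> d + (1/4)^n"
        using F(2) by (intro always_eventually allI) (smt (verit))
      show "(\<lambda>n. d + (1/4::real)^n) \<longlonglongrightarrow> d"
        using tendsto_add[OF tendsto_const[of d] LIMSEQ_realpow_zero[of "1/4::real"]] by simp
    qed simp
    ultimately show ?thesis by (rule LIMSEQ_unique)
  qed
  note [measurable] = measurable_duality_map[OF p]
  define w where "w z = duality_map p (g z)" for z
  have w_meas [measurable]: "w \<in> borel_measurable M" unfolding w_def by measurable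

  have dom: "norm (duality_map p a * b) \<le> ((A + c) powr p + 1) * c"
    if a: "norm a \<le> A + c" and b: "norm b \<le> c" for a b :: complex and A c :: real
  proof -
    have "norm a powr (p - 1) \<le> (A + c) powr (p - 1)"
      using a p by (intro powr_mono2) auto
    also have "\<dots> \<le> (A + c) powr p + 1"
    proof (cases "A + c \<le> 1")
      case True
      have "0 \<le> A + c" using a norm_ge_zero order_trans by blast
      then have "(A + c) powr (p - 1) \<le> 1" using True p by (intro powr_le1) auto
      then show ?thesis by (simp add: add_increasing)
    next
      case False
      then have "(A + c) powr (p - 1) \<le> (A + c) powr p" by (intro powr_mono) auto
      then show ?thesis by simp
    qed
    finally show ?thesis using b
      by (simp add: norm_mult norm_duality_map mult_mono)
  qed
  have pos: "0 \<le> (\<integral>z. Re (w z * G z) \<partial>M)" if G: "G \<in> V" "L G = 0" for G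
  proof -
    have [measurable]: "G \<in> borel_measurable M" using V_meas G by blast
    obtain c where c: "\<And>z. z \<in> space M \<Longrightarrow> norm (G z) \<le> c" "0 \<le> c"
      using V_bdd[OF G(1)] by (metis abs_ge_self abs_ge_zero order_trans)
    \<comment> \<open>Compare \<open>g\<close> with \<open>g + t * G\<close>, a limit of competitors, and let \<open>t\<close> decrease to \<open>0\<close>.\<close>
    define t :: "nat \<Rightarrow> real" where "t n = inverse (Suc n)" for n
    have t: "0 < t n" "t n \<le> 1" for n by (auto simp: t_def field_simps)
    have t0: "t \<longlonglongrightarrow> 0" unfolding t_def by (rule LIMSEQ_inverse_real_of_nat)
    have tc: "norm (of_real (t n) * G z) \<le> c" if "z \<in> space M" for n z
      using t[of n] c(1)[OF that] c(2) by (simp add: norm_mult mult_left_le_one_le order_trans[OF mult_left_le_one_le])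
    have gb: "norm (g z + of_real (t n) * G z) \<le> B z + c" if "norm (g z) \<le> B z" "z \<in> space M" for n z
      by (rule norm_triangle_le) (use that tc[of z n] in auto)
    have Dint: "integrable M (\<lambda>z. ((B z + c) powr p + 1) * c)"
      using Bp[OF c(2)] by auto
    have Db: "AE z in M. norm (duality_map p (g z + of_real (t n) * G z) * G z) \<le> ((B z + c) powr p + 1) * c" for n
      using ae AE_space by eventually_elim (intro dom gb c(1), auto)
    have lim: "(\<lambda>n. \<integral>z. Re (duality_map p (g z + of_real (t n) * G z) * G z) \<partial>M)
                 \<longlonglongrightarrow> (\<integral>z. Re (w z * G z) \<partial>M)"
    proof (rule integral_dominated_convergence[OF _ _ Dint])
      show "AE z in M. (\<lambda>n. Re (duality_map p (g z + of_real (t n) * G z) * G z)) \<longlonglongrightarrow> Re (w z * G z)"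
      proof (intro AE_I2)
        fix z
        have "(\<lambda>n. g z + of_real (t n) * G z) \<longlonglongrightarrow> g z + of_real 0 * G z"
          by (intro tendsto_intros t0)
        then have "(\<lambda>n. duality_map p (g z + of_real (t n) * G z)) \<longlonglongrightarrow> duality_map p (g z)"
          using continuous_on_tendsto_compose[OF continuous_on_duality_map[OF p]] by simp
        then show "(\<lambda>n. Re (duality_map p (g z + of_real (t n) * G z) * G z)) \<longlonglongrightarrow> Re (w z * G z)"
          unfolding w_def by (intro tendsto_intros)
      qed
      show "AE z in M. norm (Re (duality_map p (g z + of_real (t n) * G z) * G z))
              \<le> ((B z + c) powr p + 1) * c" for n
        using Db[of n] by eventually_elim (metis abs_Re_le_cmod order_trans real_norm_def)
    qed measurable
    have ge: "0 \<le> (\<integral>z. Re (duality_map p (g z + of_real (t n) * G z) * G z) \<partial>M)" for n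
    proof -
      define a where "a z = g z + of_real (t n) * G z" for z
      have [measurable]: "a \<in> borel_measurable M" unfolding a_def by measurable
      have tG: "(\<lambda>z. of_real (t n) * G z) \<in> V" "L (\<lambda>z. of_real (t n) * G z) = 0"
        using V_scale[OF G(1)] L_scale[OF G(1)] G(2) by auto
      have "(\<lambda>m. N (\<lambda>z. F m z + of_real (t n) * G z)) \<longlonglongrightarrow> N a"
        unfolding a_def by (rule lim_N) (use tc c in auto)
      moreover have "d \<le> N (\<lambda>z. F m z + of_real (t n) * G z)" for m
        by (rule d_le) (use V_add[OF FV(1) tG(1)] L_add[OF FV(1) tG(1)] tG FV in \<open>auto simp: S_def\<close>)
      ultimately have "d \<le> N a" by (intro LIMSEQ_le_const) auto
      have a_int: "integrable M (\<lambda>z. norm (a z) powr p)"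
      proof (rule Bochner_Integration.integrable_bound[OF Bp[OF c(2)]])
        show "AE z in M. norm (norm (a z) powr p) \<le> norm ((B z + c) powr p)"
          unfolding a_def using ae AE_space
          by eventually_elim (use p gb[of _ n] in \<open>auto intro!: powr_mono2\<close>)
      qed auto
      have D2: "integrable M (\<lambda>z. Re (duality_map p (a z) * G z))"
      proof (rule Bochner_Integration.integrable_bound[OF Dint])
        show "AE z in M. norm (Re (duality_map p (a z) * G z)) \<le> norm (((B z + c) powr p + 1) * c)"
          unfolding a_def using Db[of n]
        proof eventually_elim
          case (elim z)
          then show ?case using abs_Re_le_cmod[of "duality_map p (g z + of_real (t n) * G z) * G z"]
            by (metis abs_ge_self order_trans real_norm_def)
        qed
      qed measurable
      have "0 \<le> N a - N g" using Ng \<open>d \<le> N a\<close> by simp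
      also have "\<dots> = (\<integral>z. norm (a z) powr p - norm (g z) powr p \<partial>M)"
        unfolding N_def using a_int g_int by simp
      also have "\<dots> \<le> (\<integral>z. (p * t n) * Re (duality_map p (a z) * G z) \<partial>M)"
      proof (rule integral_mono)
        fix z
        have "norm (a z) powr p - norm (g z) powr p \<le> p * Re (duality_map p (a z) * (a z - g z))"
          by (rule norm_powr_tangent[OF p])
        also have "a z - g z = of_real (t n) * G z" by (simp add: a_def)
        also have "Re (duality_map p (a z) * (of_real (t n) * G z)) = t n * Re (duality_map p (a z) * G z)"
          by (simp add: algebra_simps)
        finally show "norm (a z) powr p - norm (g z) powr p \<le> (p * t n) * Re (duality_map p (a z) * G z)"
          by (simp only: mult.assoc)
      qed (use a_int g_int D2 in auto)
      finally have "0 \<le> (p * t n) * (\<integral>z. Re (duality_map p (a z) * G z) \<partial>M)" by simp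
      moreover have "0 < p * t n" using p t(1)[of n] by simp
      ultimately show ?thesis unfolding a_def by (meson not_le mult_pos_neg)
    qed
    show ?thesis by (rule LIMSEQ_le_const[OF lim]) (use ge in auto)
  qed
  have wV_int: "integrable M (\<lambda>z. w z * G z)" if G: "G \<in> V" for G
  proof -
    obtain c where c: "\<And>z. z \<in> space M \<Longrightarrow> norm (G z) \<le> c" "0 \<le> c"
      using V_bdd[OF G] by (metis abs_ge_self abs_ge_zero order_trans)
    have "integrable M (\<lambda>z. ((B z + c) powr p + 1) * c)" using Bp[OF c(2)] by auto
    then show ?thesis
    proof (rule Bochner_Integration.integrable_bound)
      show "AE z in M. norm (w z * G z) \<le> norm (((B z + c) powr p + 1) * c)"
        unfolding w_def using ae AE_space
      proof eventually_elim
        case (elim z)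
        then have "norm (duality_map p (g z) * G z) \<le> ((B z + c) powr p + 1) * c"
          using c by (intro dom) auto
        then show ?case by (metis abs_ge_self order_trans real_norm_def)
      qed
    qed (use V_meas[OF G] in measurable)
  qed
  have ker: "(\<integral>z. w z * G z \<partial>M) = 0" if G: "G \<in> V" "L G = 0" for G
  proof -
    have "0 \<le> Re (\<zeta> * (\<integral>z. w z * G z \<partial>M))" for \<zeta>
    proof -
      have "0 \<le> (\<integral>z. Re (w z * (\<zeta> * G z)) \<partial>M)"
        using V_scale[OF G(1)] L_scale[OF G(1)] G(2) by (intro pos) auto
      also have "\<dots> = Re (\<integral>z. w z * (\<zeta> * G z) \<partial>M)"
        by (rule integral_Re) (rule wV_int[OF V_scale[OF G(1)]])
      also have "(\<integral>z. w z * (\<zeta> * G z) \<partial>M) = (\<integral>z. \<zeta> * (w z * G z) \<partial>M)"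
        by (simp only: mult.left_commute)
      also have "\<dots> = \<zeta> * (\<integral>z. w z * G z \<partial>M)" by simp
      finally show ?thesis .
    qed
    \<comment> \<open>A number whose product with each of \<open>\<plusminus> 1\<close> and \<open>\<plusminus> \<i>\<close> has nonnegative real part is \<open>0\<close>.\<close>
    from this[of 1] this[of "-1"] this[of \<i>] this[of "-\<i>"] show ?thesis
      by (auto intro: complex_eqI)
  qed
  \<comment> \<open>All \<open>F n\<close> have the same integral against \<open>w\<close> because they differ by elements of the null space of \<open>L\<close>; in the
    limit this common value is the integral of \<open>w * g\<close>, that is, the minimum.\<close>
  have wF: "(\<integral>z. w z * F n z \<partial>M) = d" for n
  proof -
    have "(\<integral>z. w z * (F m z - F n z) \<partial>M) = 0" for m
      by (rule ker) (use V_diff[OF FV(1) FV(1)] FV in auto)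
    then have eq: "(\<integral>z. w z * F m z \<partial>M) = (\<integral>z. w z * F n z \<partial>M)" for m
      using wV_int[OF FV(1)] by (simp add: right_diff_distrib)
    have "(\<lambda>m. \<integral>z. w z * F m z \<partial>M) \<longlonglongrightarrow> (\<integral>z. w z * g z \<partial>M)"
    proof (rule integral_dominated_convergence[OF _ _ Bp[of 0]])
      show "AE z in M. (\<lambda>m. w z * F m z) \<longlonglongrightarrow> w z * g z"
        using ae by eventually_elim (auto intro!: tendsto_intros)
      show "AE z in M. norm (w z * F m z) \<le> (B z + 0) powr p" for m
        using ae
      proof eventually_elim
        case (elim z)
        have "norm (w z * F m z) \<le> B z powr (p - 1) * B z"
          unfolding w_def norm_mult norm_duality_map
          using elim p B_nonneg by (intro mult_mono powr_mono2) auto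
        then show ?case
          using powr_mult_base[OF B_nonneg, of z "p - 1"] by (simp add: mult.commute)
      qed
    qed auto
    moreover have "(\<integral>z. w z * g z \<partial>M) = of_real (N g)"
      unfolding w_def duality_map_mult_self N_def by (rule integral_complex_of_real)
    moreover have "(\<lambda>m. \<integral>z. w z * F m z \<partial>M) \<longlonglongrightarrow> (\<integral>z. w z * F n z \<partial>M)"
      by (intro tendsto_eventually always_eventually allI eq)
    ultimately show ?thesis unfolding Ng by (metis LIMSEQ_unique)
  qed
  define k where "k z = w z / d" for z
  have rep: "L G = (\<integral>z. G z * k z \<partial>M)" if G: "G \<in> V" for G
  proof -
    define G' where "G' z = G z - L G * F 0 z" for z
    have "G' \<in> V" "L G' = 0"
      unfolding G'_def using V_diff[OF G V_scale[OF FV(1)]] L_scale[OF FV(1)] FV by auto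
    then have "(\<integral>z. w z * G' z \<partial>M) = 0" by (rule ker)
    then have "(\<integral>z. w z * G z - L G * (w z * F 0 z) \<partial>M) = 0"
      by (simp add: G'_def algebra_simps)
    then have "(\<integral>z. w z * G z \<partial>M) = L G * d"
      using wV_int[OF G] wV_int[OF FV(1)] wF by simp
    moreover have "(\<integral>z. G z * k z \<partial>M) = (\<integral>z. w z * G z \<partial>M) / d"
      unfolding k_def by (simp add: mult.commute)
    ultimately show ?thesis using d_pos by simp
  qed
  have "integrable M (\<lambda>z. norm (k z) powr (p / (p - 1)))"
  proof -
    have "norm (k z) powr (p / (p - 1)) = (1 / d) powr (p / (p - 1)) * norm (g z) powr p" for z
      using p d_pos by (simp add: k_def w_def norm_divide norm_duality_map powr_divide powr_powr)
    then show ?thesis using g_int by simp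
  qed
  moreover have "k \<in> borel_measurable M" unfolding k_def by measurable
  ultimately show ?thesis using rep by blast
qed

section \<open>Potentials of finite measures in the plane\<close>

lemma emeasure_ball_complex:
  fixes c :: complex
  assumes "0 \<le> r"
  shows "emeasure lborel (ball c r) = ennreal (pi * r\<^sup>2)"
  using emeasure_ball[of r c] assms by (simp add: unit_ball_vol_2)

lemma dyadic_scale:
  fixes r t :: real
  assumes "0 < t" "t < r"
  obtains n where "r / 2 ^ Suc n \<le> t" "t < r / 2 ^ n"
proof -
  obtain m where "r / t < 2 ^ m" using real_arch_pow[of 2 "r / t"] by auto
  then have m: "r / 2 ^ m \<le> t" using assms by (simp add: field_simps)
  define n where "n = (LEAST n. r / 2 ^ Suc n \<le> t)"
  have "r / 2 ^ Suc m \<le> t" using m assms by (simp add: field_simps)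
  then have "r / 2 ^ Suc n \<le> t" unfolding n_def by (rule LeastI)
  moreover have "t < r / 2 ^ n"
  proof (cases n)
    case 0
    then show ?thesis using assms by simp
  next
    case (Suc k)
    then have "\<not> r / 2 ^ Suc k \<le> t" using not_less_Least[of k "\<lambda>n. r / 2 ^ Suc n \<le> t"] n_def by simp
    then show ?thesis using Suc by simp
  qed
  ultimately show ?thesis by (rule that)
qed

lemma dyadic_scale_from:
  fixes r t :: real
  assumes "0 < t" "t < 1 / 2 ^ N"
  obtains n where "N \<le> n" "1 / 2 ^ Suc n \<le> t" "t < 1 / 2 ^ n"
proof -
  obtain k where k: "(1 / 2 ^ N) / 2 ^ Suc k \<le> t" "t < (1 / 2 ^ N) / 2 ^ k"
    using dyadic_scale[OF assms] by blast
  show ?thesis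
    by (rule that[of "N + k"]) (use k in \<open>auto simp: power_add\<close>)
qed

lemma ennreal_term_le_suminf:
  fixes f :: "nat \<Rightarrow> ennreal"
  shows "f n \<le> suminf f"
  using sum_le_suminf[of f "{n}"] by auto

lemma tendsto_0_le_ennreal:
  fixes f g :: "'a \<Rightarrow> ennreal"
  assumes "\<forall>\<^sub>F x in F. f x \<le> g x" "(g \<longlongrightarrow> 0) F"
  shows "(f \<longlongrightarrow> 0) F"
  by (rule tendsto_sandwich[of "\<lambda>_. 0"]) (use assms in auto)

text \<open>The kernel has integral of order \<open>r\<close> over a disc of radius \<open>r\<close>, wherever its singularity lies. Near
  the singularity it is dominated by a sum over discs with dyadic radii, and each of them has area
  proportional to the square of the radius; elsewhere on the disc the kernel is at most \<open>1 / r\<close>.\<close>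

lemma nn_integral_kernel_ball:
  fixes a z :: complex
  assumes r: "0 < r"
  shows "(\<integral>\<^sup>+x\<in>ball a r. ennreal (inverse (norm (z - x))) \<partial>lborel) \<le> ennreal (5 * pi * r)"
proof -
  note [measurable] = borel_open[OF open_ball]
  let ?f = "\<lambda>n x. ennreal (2 ^ Suc n / r) * indicator (ball z (r / 2 ^ n)) x"
  have pt: "ennreal (inverse (norm (z - x))) * indicator (ball a r) x
              \<le> (\<Sum>n. ?f n x) + ennreal (1 / r) * indicator (ball a r) x" for x
  proof (cases "x = z \<or> x \<notin> ball a r")
    case True
    then show ?thesis by auto
  next
    case False
    show ?thesis
    proof (cases "norm (z - x) < r")
      case True
      then obtain n where n: "r / 2 ^ Suc n \<le> norm (z - x)" "norm (z - x) < r / 2 ^ n"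
        using False dyadic_scale[of "norm (z - x)" r] by auto
      have "inverse (norm (z - x)) \<le> inverse (r / 2 ^ Suc n)"
        using n r by (intro le_imp_inverse_le) auto
      then have "ennreal (inverse (norm (z - x))) \<le> ?f n x"
        using n by (simp add: dist_norm ennreal_leI)
      also have "\<dots> \<le> (\<Sum>n. ?f n x)"
        by (rule ennreal_term_le_suminf)
      finally show ?thesis using False by (simp add: add_increasing2)
    next
      case far: False
      then have "inverse (norm (z - x)) \<le> 1 / r"
        using r by (simp add: le_imp_inverse_le inverse_eq_divide[symmetric])
      then show ?thesis using False by (simp add: add_increasing ennreal_leI)
    qed
  qed
  have "(\<integral>\<^sup>+x\<in>ball a r. ennreal (inverse (norm (z - x))) \<partial>lborel)
          \<le> (\<integral>\<^sup>+x. (\<Sum>n. ?f n x) + ennreal (1 / r) * indicator (ball a r) x \<partial>lborel)"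
    by (intro nn_integral_mono pt)
  also have "\<dots> = (\<Sum>n. \<integral>\<^sup>+x. ?f n x \<partial>lborel) + ennreal (1 / r) * ennreal (pi * r\<^sup>2)"
    using r by (simp add: nn_integral_add nn_integral_suminf nn_integral_cmult_indicator emeasure_ball_complex)
  also have "(\<Sum>n. \<integral>\<^sup>+x. ?f n x \<partial>lborel) = (\<Sum>n. ennreal (2 * pi * r * (1/2) ^ n))"
  proof (rule suminf_cong)
    fix n
    have "(\<integral>\<^sup>+x. ?f n x \<partial>lborel) = ennreal (2 ^ Suc n / r) * ennreal (pi * (r / 2 ^ n)\<^sup>2)"
      using r by (simp add: nn_integral_cmult_indicator emeasure_ball_complex)
    also have "\<dots> = ennreal (2 ^ Suc n / r * (pi * (r / 2 ^ n)\<^sup>2))"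
      using r by (intro ennreal_mult[symmetric]) auto
    also have "2 ^ Suc n / r * (pi * (r / 2 ^ n)\<^sup>2) = 2 * pi * r * (1/2) ^ n"
      using r by (simp add: field_simps power2_eq_square)
    finally show "(\<integral>\<^sup>+x. ?f n x \<partial>lborel) = ennreal (2 * pi * r * (1/2) ^ n)" .
  qed
  also have "\<dots> = ennreal (\<Sum>n. 2 * pi * r * (1/2) ^ n)"
    using r by (intro suminf_ennreal2 summable_mult summable_geometric) auto
  also have "(\<Sum>n. 2 * pi * r * (1/2::real) ^ n) = 4 * pi * r"
    by (subst suminf_mult) (auto simp: suminf_geometric summable_geometric)
  also have "ennreal (1 / r) * ennreal (pi * r\<^sup>2) = ennreal (pi * r)"
    using r by (subst ennreal_mult[symmetric]) (auto simp: power2_eq_square)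
  also have "ennreal (4 * pi * r) + ennreal (pi * r) = ennreal (5 * pi * r)"
    using r by (subst ennreal_plus[symmetric]) (auto simp: algebra_simps)
  finally show ?thesis .
qed

text \<open>Since \<open>inverse 0 = 0\<close>, a point mass does not contribute to the potential at its own position. For
  measures without atoms, which are the ones of interest here, this makes no difference.\<close>

definition riesz_potential :: "complex measure \<Rightarrow> complex \<Rightarrow> ennreal" where
  "riesz_potential \<nu> x = (\<integral>\<^sup>+z. ennreal (inverse (norm (z - x))) \<partial>\<nu>)"

context
  fixes \<nu> :: "complex measure"
  assumes fin: "finite_measure \<nu>" and sets_\<nu> [measurable_cong]: "sets \<nu> = sets borel"
begin

interpretation \<nu>: finite_measure \<nu> by (rule fin)
interpretation pair_sigma_finite \<nu> "lborel :: complex measure" ..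

lemma emeasure_UNIV_finite: "emeasure \<nu> UNIV < top"
  using \<nu>.emeasure_finite[of UNIV] by (simp only: infinity_ennreal_def less_top)

lemma measurable_riesz_potential: "riesz_potential \<nu> \<in> borel_measurable borel"
proof -
  have "(\<lambda>x. \<integral>\<^sup>+z. ennreal (inverse (norm (z - x))) \<partial>\<nu>) \<in> borel_measurable lborel"
    by measurable
  then show ?thesis by (simp add: riesz_potential_def[abs_def])
qed

lemma nn_integral_riesz_potential:
  assumes [measurable]: "A \<in> sets borel"
  shows "(\<integral>\<^sup>+x\<in>A. riesz_potential \<nu> x \<partial>lborel)
           = (\<integral>\<^sup>+z. (\<integral>\<^sup>+x\<in>A. ennreal (inverse (norm (z - x))) \<partial>lborel) \<partial>\<nu>)"
proof -
  have "(\<integral>\<^sup>+x\<in>A. riesz_potential \<nu> x \<partial>lborel)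
     = (\<integral>\<^sup>+x. (\<integral>\<^sup>+z. ennreal (inverse (norm (z - x))) * indicator A x \<partial>\<nu>) \<partial>lborel)"
    unfolding riesz_potential_def by (intro nn_integral_cong nn_integral_multc[symmetric]) measurable
  also have "\<dots> = (\<integral>\<^sup>+z. (\<integral>\<^sup>+x. ennreal (inverse (norm (z - x))) * indicator A x \<partial>lborel) \<partial>\<nu>)"
    by (rule Fubini') measurable
  finally show ?thesis .
qed

lemma nn_integral_riesz_potential_ball:
  assumes "0 < r"
  shows "(\<integral>\<^sup>+x\<in>ball a r. riesz_potential \<nu> x \<partial>lborel) \<le> ennreal (5 * pi * r) * emeasure \<nu> UNIV"
proof -
  have "(\<integral>\<^sup>+x\<in>ball a r. riesz_potential \<nu> x \<partial>lborel) \<le> (\<integral>\<^sup>+z. ennreal (5 * pi * r) \<partial>\<nu>)"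
    unfolding nn_integral_riesz_potential[OF borel_open[OF open_ball]]
    by (intro nn_integral_mono nn_integral_kernel_ball assms)
  also have "\<dots> = ennreal (5 * pi * r) * emeasure \<nu> UNIV"
    using sets_eq_imp_space_eq[OF sets_\<nu>] by simp
  finally show ?thesis .
qed

text \<open>By Tonelli's theorem the potential has a finite integral over every disc.\<close>

lemma AE_riesz_potential_finite: "AE x in lborel. riesz_potential \<nu> x \<noteq> \<infinity>"
proof -
  have "AE x in lborel. \<forall>n. x \<in> ball 0 (real (Suc n)) \<longrightarrow> riesz_potential \<nu> x \<noteq> \<infinity>"
  proof (intro AE_all_countable[THEN iffD2] allI)
    fix n
    note [measurable] = measurable_riesz_potential borel_open[OF open_ball]
    have "(\<integral>\<^sup>+x\<in>ball 0 (real (Suc n)). riesz_potential \<nu> x \<partial>lborel)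
            \<le> ennreal (5 * pi * real (Suc n)) * emeasure \<nu> UNIV"
      by (rule nn_integral_riesz_potential_ball) simp
    also have "\<dots> < \<infinity>" using emeasure_UNIV_finite by (simp add: ennreal_mult_less_top)
    finally have "AE x in lborel. riesz_potential \<nu> x * indicator (ball 0 (real (Suc n))) x \<noteq> \<infinity>"
      by (intro nn_integral_PInf_AE) auto
    then show "AE x in lborel. x \<in> ball 0 (real (Suc n)) \<longrightarrow> riesz_potential \<nu> x \<noteq> \<infinity>"
      by eventually_elim auto
  qed
  then show ?thesis
  proof eventually_elim
    case (elim x)
    obtain n where "norm x < real n" using reals_Archimedean2 by blast
    then have "x \<in> ball 0 (real (Suc n))" by simp
    then show ?case using elim by blast
  qed
qed

text \<open>Tonelli's theorem turns the average into the \<open>\<nu>\<close>-integral of \<open>\<psi> n\<close>, the integral of the kernel over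
  the disc of radius \<open>r n\<close>, divided by \<open>r n\<close>. These functions are uniformly bounded, and for \<open>z \<noteq> x0\<close>
  they tend to \<open>0\<close> because the kernel stays bounded near \<open>x0\<close>. As \<open>\<nu>\<close> has no mass at \<open>x0\<close>, dominated
  convergence applies.\<close>

lemma riesz_potential_average_tendsto_0:
  fixes r :: "nat \<Rightarrow> real"
  assumes atom: "emeasure \<nu> {x0} = 0" and r: "\<And>n. 0 < r n" "r \<longlonglongrightarrow> 0"
  shows "(\<lambda>n. ennreal (1 / (r n)\<^sup>2) *
           (\<integral>\<^sup>+x\<in>ball x0 (r n). ennreal (norm (x - x0)) * riesz_potential \<nu> x \<partial>lborel)) \<longlonglongrightarrow> 0"
proof -
  define \<psi> where "\<psi> n z = ennreal (1 / r n) * (\<integral>\<^sup>+x\<in>ball x0 (r n). ennreal (inverse (norm (z - x))) \<partial>lborel)" for n z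
  note [measurable] = measurable_riesz_potential
  have [measurable]: "ball x0 (r n) \<in> sets borel" for n by simp
  have [measurable]: "\<psi> n \<in> borel_measurable \<nu>" for n
    unfolding \<psi>_def by measurable
  have \<psi>_bound: "\<psi> n z \<le> ennreal (5 * pi)" for n z
  proof -
    have "\<psi> n z \<le> ennreal (1 / r n) * ennreal (5 * pi * r n)"
      unfolding \<psi>_def by (intro mult_left_mono nn_integral_kernel_ball r) auto
    also have "\<dots> = ennreal (5 * pi)"
      using r(1)[of n] by (subst ennreal_mult[symmetric]) auto
    finally show ?thesis .
  qed
  have \<psi>_lim: "(\<lambda>n. \<psi> n z) \<longlonglongrightarrow> 0" if "z \<noteq> x0" for z
  proof -
    define \<delta> where "\<delta> = norm (z - x0)"
    have \<delta>: "0 < \<delta>" using that by (simp add: \<delta>_def)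
    have "\<psi> n z \<le> ennreal (2 * pi / \<delta> * r n)" if "r n < \<delta> / 2" for n
    proof -
      have "inverse (norm (z - x)) \<le> 2 / \<delta>" if "x \<in> ball x0 (r n)" for x
      proof -
        have "\<delta> \<le> norm (z - x) + norm (x - x0)" unfolding \<delta>_def by (metis diff_add_cancel add_diff_eq norm_triangle_ineq)
        then have "\<delta> / 2 \<le> norm (z - x)"
          using that \<open>r n < \<delta> / 2\<close> by (simp add: dist_norm norm_minus_commute)
        then have "inverse (norm (z - x)) \<le> inverse (\<delta> / 2)" using \<delta> by (intro le_imp_inverse_le) auto
        then show ?thesis by simp
      qed
      then have "(\<integral>\<^sup>+x\<in>ball x0 (r n). ennreal (inverse (norm (z - x))) \<partial>lborel)
              \<le> (\<integral>\<^sup>+x. ennreal (2 / \<delta>) * indicator (ball x0 (r n)) x \<partial>lborel)"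
        by (intro nn_integral_mono) (auto split: split_indicator intro: ennreal_leI)
      also have "\<dots> = ennreal (2 / \<delta>) * ennreal (pi * (r n)\<^sup>2)"
        using r(1)[of n] by (simp add: nn_integral_cmult_indicator emeasure_ball_complex)
      finally have "\<psi> n z \<le> ennreal (1 / r n) * (ennreal (2 / \<delta>) * ennreal (pi * (r n)\<^sup>2))"
        unfolding \<psi>_def by (intro mult_left_mono) auto
      also have "\<dots> = ennreal (1 / r n * (2 / \<delta> * (pi * (r n)\<^sup>2)))"
        using r(1)[of n] \<delta> by (simp flip: ennreal_mult)
      also have "1 / r n * (2 / \<delta> * (pi * (r n)\<^sup>2)) = 2 * pi / \<delta> * r n"
        using r(1)[of n] by (simp add: power2_eq_square)
      finally show ?thesis .
    qed
    moreover have "\<forall>\<^sub>F n in sequentially. r n < \<delta> / 2"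
      using \<delta> by (intro order_tendstoD[OF r(2)]) auto
    ultimately have "\<forall>\<^sub>F n in sequentially. \<psi> n z \<le> ennreal (2 * pi / \<delta> * r n)"
      by (auto elim: eventually_mono)
    moreover have "(\<lambda>n. ennreal (2 * pi / \<delta> * r n)) \<longlonglongrightarrow> ennreal 0"
      by (intro tendsto_ennrealI tendsto_mult_right_zero r)
    ultimately show ?thesis
      unfolding ennreal_0 by (rule tendsto_0_le_ennreal)
  qed
  have "(\<lambda>n. \<integral>\<^sup>+z. \<psi> n z \<partial>\<nu>) \<longlonglongrightarrow> (\<integral>\<^sup>+z. 0 \<partial>\<nu>)"
  proof (rule nn_integral_dominated_convergence[where w="\<lambda>_. ennreal (5 * pi)"])
    show "(\<integral>\<^sup>+z. ennreal (5 * pi) \<partial>\<nu>) < \<infinity>"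
      using emeasure_UNIV_finite sets_eq_imp_space_eq[OF sets_\<nu>] by (simp add: ennreal_mult_less_top)
    have "AE z in \<nu>. z \<noteq> x0"
      by (rule AE_I[where N="{x0}"]) (use atom sets_\<nu> in auto)
    then show "AE z in \<nu>. (\<lambda>n. \<psi> n z) \<longlonglongrightarrow> 0"
      by eventually_elim (rule \<psi>_lim)
  qed (use \<psi>_bound in auto)
  moreover have "ennreal (1 / (r n)\<^sup>2) *
           (\<integral>\<^sup>+x\<in>ball x0 (r n). ennreal (norm (x - x0)) * riesz_potential \<nu> x \<partial>lborel)
         \<le> (\<integral>\<^sup>+z. \<psi> n z \<partial>\<nu>)" for n
  proof -
    have "(\<integral>\<^sup>+x\<in>ball x0 (r n). ennreal (norm (x - x0)) * riesz_potential \<nu> x \<partial>lborel)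
        \<le> (\<integral>\<^sup>+x. ennreal (r n) * (riesz_potential \<nu> x * indicator (ball x0 (r n)) x) \<partial>lborel)"
      by (intro nn_integral_mono)
         (auto split: split_indicator simp: dist_norm norm_minus_commute intro!: mult_right_mono ennreal_leI)
    also have "\<dots> = ennreal (r n) * (\<integral>\<^sup>+z. (\<integral>\<^sup>+x\<in>ball x0 (r n). ennreal (inverse (norm (z - x))) \<partial>lborel) \<partial>\<nu>)"
      by (subst nn_integral_cmult) (auto simp: nn_integral_riesz_potential)
    finally have "ennreal (1 / (r n)\<^sup>2) *
           (\<integral>\<^sup>+x\<in>ball x0 (r n). ennreal (norm (x - x0)) * riesz_potential \<nu> x \<partial>lborel)
        \<le> ennreal (1 / (r n)\<^sup>2) * (ennreal (r n) * (\<integral>\<^sup>+z. (\<integral>\<^sup>+x\<in>ball x0 (r n). ennreal (inverse (norm (z - x))) \<partial>lborel) \<partial>\<nu>))"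
      by (intro mult_left_mono) auto
    also have "\<dots> = ennreal (1 / r n) * (\<integral>\<^sup>+z. (\<integral>\<^sup>+x\<in>ball x0 (r n). ennreal (inverse (norm (z - x))) \<partial>lborel) \<partial>\<nu>)"
      using r(1)[of n] by (simp add: mult.assoc[symmetric] ennreal_mult[symmetric] power2_eq_square)
    also have "\<dots> = (\<integral>\<^sup>+z. \<psi> n z \<partial>\<nu>)"
      unfolding \<psi>_def by (rule nn_integral_cmult[symmetric]) measurable
    finally show ?thesis .
  qed
  ultimately show ?thesis
    by - (rule tendsto_0_le_ennreal[OF always_eventually, of _ "\<lambda>n. \<integral>\<^sup>+z. \<psi> n z \<partial>\<nu>"], simp_all)
qed

end

text \<open>Markov's inequality bounds the area on which \<open>Q\<close> exceeds a fixed threshold. To obtain one set along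
  which \<open>Q\<close> tends to \<open>0\<close>, the threshold \<open>\<eta> n\<close> depends on the dyadic annulus around \<open>x0\<close>. It is chosen
  as the square root of the average \<open>b n\<close>: thus it tends to \<open>0\<close>, and so does the proportion
  \<open>b n / \<eta> n\<close> of area that is lost.\<close>

lemma full_density_limit_of_average_tendsto_0:
  fixes Q :: "complex \<Rightarrow> ennreal"
  assumes Q [measurable]: "Q \<in> borel_measurable borel"
    and avg: "(\<lambda>n. ennreal (1 / (1 / 2 ^ n)\<^sup>2) * (\<integral>\<^sup>+x\<in>ball x0 (1 / 2 ^ n). Q x \<partial>lborel)) \<longlonglongrightarrow> 0"
  shows "\<exists>S\<in>sets borel. full_area_density S x0 \<and> (Q \<longlongrightarrow> 0) (at x0 within S)"
proof -
  define b where "b n = enn2real (ennreal (1 / (1 / 2 ^ n)\<^sup>2) * (\<integral>\<^sup>+x\<in>ball x0 (1 / 2 ^ n). Q x \<partial>lborel))" for n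
  have b_nonneg: "0 \<le> b n" for n by (simp add: b_def)
  have b_lim: "b \<longlonglongrightarrow> 0"
    unfolding b_def by (rule tendsto_enn2real[where l=0, simplified, OF avg])
  \<comment> \<open>The second summand keeps the threshold positive where the average vanishes.\<close>
  define \<eta> where "\<eta> n = sqrt (b n) + (1/2) ^ n" for n
  have \<eta>_pos: "0 < \<eta> n" for n using b_nonneg by (simp add: \<eta>_def add_nonneg_pos)
  have \<eta>_lim: "\<eta> \<longlonglongrightarrow> 0"
    unfolding \<eta>_def using tendsto_add[OF tendsto_real_sqrt[OF b_lim] LIMSEQ_realpow_zero[of "1/2::real"]] by simp
  define bad where "bad n = {x \<in> ball x0 (1 / 2 ^ n). ennreal (\<eta> n) \<le> Q x}" for n
  have [measurable]: "bad n \<in> sets borel" for n unfolding bad_def by measurable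
  define S where "S = {x. \<forall>n. 1 / 2 ^ Suc n \<le> dist x0 x \<and> dist x0 x < 1 / 2 ^ n \<longrightarrow> Q x < ennreal (\<eta> n)}"
  have S_meas [measurable]: "S \<in> sets borel" unfolding S_def by measurable
  have fin: "\<forall>\<^sub>F n in sequentially. ennreal (1 / (1 / 2 ^ n)\<^sup>2) * (\<integral>\<^sup>+x\<in>ball x0 (1 / 2 ^ n). Q x \<partial>lborel) < \<infinity>"
    by (rule order_tendstoD(2)[OF avg]) simp
  \<comment> \<open>The first averages may be infinite, and then their real values carry no information.\<close>
  obtain N0 where N0: "\<And>n. N0 \<le> n \<Longrightarrow>
      ennreal (1 / (1 / 2 ^ n)\<^sup>2) * (\<integral>\<^sup>+x\<in>ball x0 (1 / 2 ^ n). Q x \<partial>lborel) = ennreal (b n)"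
  proof -
    have "\<forall>\<^sub>F n in sequentially.
        ennreal (1 / (1 / 2 ^ n)\<^sup>2) * (\<integral>\<^sup>+x\<in>ball x0 (1 / 2 ^ n). Q x \<partial>lborel) = ennreal (b n)"
      using fin by eventually_elim (simp only: b_def infinity_ennreal_def ennreal_enn2real)
    then show ?thesis unfolding eventually_sequentially using that by blast
  qed
  have four: "(4::real) ^ n = 2 ^ n * 2 ^ n" for n by (simp flip: power_mult_distrib)
  have bad_le: "emeasure lborel (bad n) \<le> ennreal (sqrt (b n) * (1/4) ^ n)" if "N0 \<le> n" for n
  proof -
    let ?I = "\<integral>\<^sup>+x\<in>ball x0 (1 / 2 ^ n). Q x \<partial>lborel"
    have I: "?I = ennreal ((1/4)^n * b n)"
    proof -
      have "ennreal ((1/4)^n) * (ennreal (4 ^ n) * ?I) = ennreal ((1/4)^n) * ennreal (b n)"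
        using N0[OF that] by (simp add: four power2_eq_square)
      moreover have "ennreal ((1/4)^n) * (ennreal (4 ^ n) * ?I) = ?I"
        by (simp add: mult.assoc[symmetric] ennreal_mult[symmetric] power_divide)
      ultimately show ?thesis using b_nonneg by (simp add: ennreal_mult)
    qed
    have "ennreal (\<eta> n) * emeasure lborel (bad n) = (\<integral>\<^sup>+x. ennreal (\<eta> n) * indicator (bad n) x \<partial>lborel)"
      by (simp add: nn_integral_cmult_indicator)
    also have "\<dots> \<le> ?I"
      by (intro nn_integral_mono) (auto simp: bad_def split: split_indicator)
    finally have "ennreal (1 / \<eta> n) * (ennreal (\<eta> n) * emeasure lborel (bad n)) \<le> ennreal (1 / \<eta> n) * ennreal ((1/4)^n * b n)"
      unfolding I by (intro mult_left_mono) auto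
    moreover have "ennreal (1 / \<eta> n) * (ennreal (\<eta> n) * emeasure lborel (bad n)) = emeasure lborel (bad n)"
      using \<eta>_pos[of n] by (simp add: mult.assoc[symmetric] ennreal_mult[symmetric])
    moreover have "ennreal (1 / \<eta> n) * ennreal ((1/4)^n * b n) = ennreal ((b n / \<eta> n) * (1/4)^n)"
      using \<eta>_pos[of n] b_nonneg[of n] by (simp add: ennreal_mult[symmetric] mult.commute)
    moreover have "b n / \<eta> n \<le> sqrt (b n)"
    proof -
      have "b n \<le> sqrt (b n) * \<eta> n"
        unfolding \<eta>_def using b_nonneg[of n] by (simp add: algebra_simps)
      then show ?thesis using \<eta>_pos[of n] by (simp add: field_simps)
    qed
    then have "ennreal ((b n / \<eta> n) * (1/4)^n) \<le> ennreal (sqrt (b n) * (1/4)^n)"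
      by (intro ennreal_leI mult_right_mono) auto
    ultimately show ?thesis by simp
  qed
  \<comment> \<open>The discarded sets in the annuli of index at least \<open>n\<close> have total area at most
    \<open>\<epsilon> / 6 * 4 / 3 * (1/4) ^ n\<close>, and \<open>(1/4) ^ n \<le> 4 * r\<^sup>2\<close> if \<open>r \<ge> 1 / 2 ^ Suc n\<close>; the factor
    \<open>6\<close> leaves a margin.\<close>
  have small: "measure lborel (ball x0 r - S) \<le> \<epsilon> * r\<^sup>2"
    if N: "N0 \<le> N" "\<And>n. N \<le> n \<Longrightarrow> 6 * sqrt (b n) \<le> \<epsilon>" and r: "0 < r" "r < 1 / 2 ^ N" for N \<epsilon> r
  proof -
    obtain n where n: "N \<le> n" "1 / 2 ^ Suc n \<le> r" "r < 1 / 2 ^ n"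
      using dyadic_scale_from[OF r] by blast
    have "ball x0 r - S \<subseteq> (\<Union>i. bad (n + i))"
    proof
      fix x assume x: "x \<in> ball x0 r - S"
      then obtain m where m: "1 / 2 ^ Suc m \<le> dist x0 x" "dist x0 x < 1 / 2 ^ m" "ennreal (\<eta> m) \<le> Q x"
        unfolding S_def by (auto simp: not_less)
      have "1 / 2 ^ Suc m < (1 / 2 ^ n :: real)" using m x n by simp
      then have "(2::real) ^ n < 2 ^ Suc m" by (simp add: field_simps)
      then have "n < Suc m" by (rule power_less_imp_less_exp[rotated]) simp
      then obtain i where "m = n + i" using le_Suc_ex[of n m] by auto
      then show "x \<in> (\<Union>i. bad (n + i))" using m by (auto simp: bad_def)
    qed
    then have "emeasure lborel (ball x0 r - S) \<le> emeasure lborel (\<Union>i. bad (n + i))"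
      by (intro emeasure_mono) auto
    also have "\<dots> \<le> (\<Sum>i. emeasure lborel (bad (n + i)))"
      by (intro emeasure_subadditive_countably) auto
    also have "\<dots> \<le> (\<Sum>i. ennreal (\<epsilon> / 6 * (1/4) ^ n * (1/4) ^ i))"
    proof (intro suminf_le summableI)
      fix i
      have "emeasure lborel (bad (n + i)) \<le> ennreal (sqrt (b (n + i)) * (1/4) ^ (n + i))"
        using N n by (intro bad_le) auto
      also have "\<dots> \<le> ennreal (\<epsilon> / 6 * (1/4) ^ (n + i))"
        using N(2)[of "n + i"] n by (intro ennreal_leI mult_right_mono) auto
      finally show "emeasure lborel (bad (n + i)) \<le> ennreal (\<epsilon> / 6 * (1/4) ^ n * (1/4) ^ i)"
        by (simp only: power_add mult.assoc)
    qed
    also have "\<dots> = ennreal (\<Sum>i. \<epsilon> / 6 * (1/4) ^ n * (1/4) ^ i)"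
    proof (rule suminf_ennreal2)
      show "summable (\<lambda>i. \<epsilon> / 6 * (1/4) ^ n * (1/4::real) ^ i)"
        by (rule summable_mult, rule summable_geometric) simp
      have "0 \<le> \<epsilon>" using N(2)[of N] b_nonneg[of N] real_sqrt_ge_zero[of "b N"] by linarith
      then show "0 \<le> \<epsilon> / 6 * (1/4) ^ n * (1/4) ^ i" for i by simp
    qed
    also have "(\<Sum>i. \<epsilon> / 6 * (1/4) ^ n * (1/4::real) ^ i) = \<epsilon> * (2/9 * (1/4) ^ n)"
      by (subst suminf_mult) (auto simp: suminf_geometric summable_geometric)
    finally have "emeasure lborel (ball x0 r - S) \<le> ennreal (\<epsilon> * (2/9 * (1/4) ^ n))" .
    moreover have \<epsilon>: "0 \<le> \<epsilon>"
      using N(2)[of N] b_nonneg[of N] real_sqrt_ge_zero[of "b N"] by linarith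
    ultimately have "measure lborel (ball x0 r - S) \<le> \<epsilon> * (2/9 * (1/4) ^ n)"
      unfolding measure_def by (intro enn2real_leI) auto
    also have "\<dots> \<le> \<epsilon> * r\<^sup>2"
    proof (intro mult_left_mono \<epsilon>)
      have "(1 / 2 ^ Suc n)\<^sup>2 \<le> r\<^sup>2" using n by (intro power_mono) auto
      then show "2/9 * (1/4) ^ n \<le> r\<^sup>2"
        by (simp add: power_divide power2_eq_square four) (simp add: field_simps)
    qed
    finally show ?thesis .
  qed
  have "full_area_density S x0"
    unfolding full_area_density_def
  proof (intro conjI LIMSEQ_I)
    show "S \<in> sets lebesgue" using S_meas by simp
    fix \<epsilon> :: real assume \<epsilon>: "0 < \<epsilon>"
    have "(\<lambda>n. 6 * sqrt (b n)) \<longlonglongrightarrow> 6 * sqrt 0"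
      by (intro tendsto_intros b_lim)
    then have "\<forall>\<^sub>F n in sequentially. 6 * sqrt (b n) < \<epsilon>"
      using \<epsilon> by (intro order_tendstoD(2)) auto
    then obtain N1 where N1: "\<And>n. N1 \<le> n \<Longrightarrow> 6 * sqrt (b n) < \<epsilon>"
      unfolding eventually_sequentially by blast
    define N where "N = max N0 N1"
    obtain M where M: "2 ^ N < real M" using reals_Archimedean2 by blast
    show "\<exists>no. \<forall>n\<ge>no. norm (measure lebesgue (ball x0 (1 / real n) - S) /
               measure lebesgue (ball x0 (1 / real n)) - 0) < \<epsilon>"
    proof (intro exI allI impI)
      fix n assume "M \<le> n"
      then have n: "2 ^ N < real n" using M by linarith
      then have npos: "0 < real n" by (smt (verit) zero_less_power)
      have bound: "measure lborel (ball x0 (1 / real n) - S) \<le> \<epsilon> * (1 / real n)\<^sup>2"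
        using N1 npos n by (intro small[of N]) (auto simp: N_def field_simps intro: less_imp_le)
      have area: "measure lborel (ball x0 (1 / real n)) = pi * (1 / real n)\<^sup>2"
        using npos by (simp add: measure_def emeasure_ball_complex)
      have "measure lborel (ball x0 (1 / real n) - S) / measure lborel (ball x0 (1 / real n))
          \<le> \<epsilon> * (1 / real n)\<^sup>2 / (pi * (1 / real n)\<^sup>2)"
        unfolding area by (intro divide_right_mono bound) simp
      also have "\<dots> = \<epsilon> / pi" using npos by simp
      also have "\<dots> < \<epsilon>" using \<epsilon> pi_gt3 by (simp add: field_simps)
      finally show "norm (measure lebesgue (ball x0 (1 / real n) - S) /
               measure lebesgue (ball x0 (1 / real n)) - 0) < \<epsilon>"
        by simp
    qed
  qed
  moreover have "(Q \<longlongrightarrow> 0) (at x0 within S)"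
  proof (rule order_tendstoI)
    fix \<delta> :: ennreal assume \<delta>: "0 < \<delta>"
    have "(\<lambda>n. ennreal (\<eta> n)) \<longlonglongrightarrow> 0" using tendsto_ennrealI[OF \<eta>_lim] by simp
    then have "\<forall>\<^sub>F n in sequentially. ennreal (\<eta> n) < \<delta>" using \<delta> by (rule order_tendstoD)
    then obtain N where N: "\<And>n. N \<le> n \<Longrightarrow> ennreal (\<eta> n) < \<delta>"
      unfolding eventually_sequentially by blast
    show "\<forall>\<^sub>F x in at x0 within S. Q x < \<delta>"
      unfolding eventually_at
    proof (intro exI[of _ "1 / 2 ^ N"] conjI ballI impI)
      fix x assume x: "x \<in> S" "x \<noteq> x0 \<and> dist x x0 < 1 / 2 ^ N"
      then obtain n where n: "N \<le> n" "1 / 2 ^ Suc n \<le> dist x0 x" "dist x0 x < 1 / 2 ^ n"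
        using dyadic_scale_from[of "dist x0 x" N] by (metis dist_commute zero_less_dist_iff)
      then have "Q x < ennreal (\<eta> n)" using x unfolding S_def by blast
      then show "Q x < \<delta>" using N[OF n(1)] by order
    qed simp
  qed simp
  ultimately show ?thesis using S_meas by blast
qed

section \<open>Rational functions\<close>

text \<open>The functions that agree with a rational function wherever its denominator does not vanish. A quotient
  of polynomials has the value \<open>0\<close> at the zeros of its denominator, so the set \<^const>\<open>rational_off\<close> is in
  general not closed under pointwise addition: if \<open>0 \<notin> X\<close>, the sum of \<open>1 / z\<close> and \<open>1\<close>
  has the value \<open>1\<close> at \<open>0\<close>, but a quotient that is unbounded near \<open>0\<close> has the value \<open>0\<close> there.
  Leaving the values at these zeros free gives a linear space with the
  same restrictions to \<open>X\<close> and the same derivatives there.\<close>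

definition rational_near :: "complex set \<Rightarrow> (complex \<Rightarrow> complex) set" where
  "rational_near X = {F. \<exists>P Q. (\<forall>z\<in>X. poly Q z \<noteq> 0) \<and> (\<forall>z. poly Q z \<noteq> 0 \<longrightarrow> F z = poly P z / poly Q z)}"

lemma rational_nearI:
  assumes "\<And>z. z \<in> X \<Longrightarrow> poly Q z \<noteq> 0" "\<And>z. poly Q z \<noteq> 0 \<Longrightarrow> F z = poly P z / poly Q z"
  shows "F \<in> rational_near X"
  unfolding rational_near_def using assms by blast

lemma rational_nearE:
  assumes "F \<in> rational_near X"
  obtains P Q where "\<And>z. z \<in> X \<Longrightarrow> poly Q z \<noteq> 0" "\<And>z. poly Q z \<noteq> 0 \<Longrightarrow> F z = poly P z / poly Q z"
  using assms unfolding rational_near_def by blast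

lemma rational_off_subset_near: "F \<in> rational_off X \<Longrightarrow> F \<in> rational_near X"
  unfolding rational_off_def rational_near_def by auto

lemma rational_near_poly: "(\<lambda>z. poly P z) \<in> rational_near X"
  by (rule rational_nearI[of _ 1 _ P]) auto

lemma rational_near_const: "(\<lambda>z. c) \<in> rational_near X"
  using rational_near_poly[of "[:c:]"] by simp

lemma rational_near_linear: "(\<lambda>z. z - c) \<in> rational_near X"
  using rational_near_poly[of "[:-c, 1:]"] by simp

lemma rational_near_inverse:
  assumes "x \<notin> X"
  shows "(\<lambda>z. inverse (z - x)) \<in> rational_near X"
  by (rule rational_nearI[of _ "[:-x, 1:]" _ 1]) (use assms in \<open>auto simp: inverse_eq_divide\<close>)

lemma rational_near_mult:
  assumes "F \<in> rational_near X" "G \<in> rational_near X"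
  shows "(\<lambda>z. F z * G z) \<in> rational_near X"
proof -
  obtain P Q where F: "\<And>z. z \<in> X \<Longrightarrow> poly Q z \<noteq> 0" "\<And>z. poly Q z \<noteq> 0 \<Longrightarrow> F z = poly P z / poly Q z"
    using rational_nearE[OF assms(1)] by metis
  obtain P' Q' where G: "\<And>z. z \<in> X \<Longrightarrow> poly Q' z \<noteq> 0" "\<And>z. poly Q' z \<noteq> 0 \<Longrightarrow> G z = poly P' z / poly Q' z"
    using rational_nearE[OF assms(2)] by metis
  show ?thesis
    by (rule rational_nearI[of _ "Q * Q'" _ "P * P'"]) (use F G in auto)
qed

lemma rational_near_add:
  assumes "F \<in> rational_near X" "G \<in> rational_near X"
  shows "(\<lambda>z. F z + G z) \<in> rational_near X"
proof -
  obtain P Q where F: "\<And>z. z \<in> X \<Longrightarrow> poly Q z \<noteq> 0" "\<And>z. poly Q z \<noteq> 0 \<Longrightarrow> F z = poly P z / poly Q z"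
    using rational_nearE[OF assms(1)] by metis
  obtain P' Q' where G: "\<And>z. z \<in> X \<Longrightarrow> poly Q' z \<noteq> 0" "\<And>z. poly Q' z \<noteq> 0 \<Longrightarrow> G z = poly P' z / poly Q' z"
    using rational_nearE[OF assms(2)] by metis
  show ?thesis
    by (rule rational_nearI[of _ "Q * Q'" _ "P * Q' + P' * Q"]) (use F G in \<open>auto simp: field_simps\<close>)
qed

lemma rational_near_difference_quotient:
  assumes "F \<in> rational_near X" "x \<in> X"
  obtains R where "R \<in> rational_near X" "\<And>z. z \<in> X \<Longrightarrow> (z - x) * R z = F z - F x"
proof -
  obtain P Q where F: "\<And>z. z \<in> X \<Longrightarrow> poly Q z \<noteq> 0" "\<And>z. poly Q z \<noteq> 0 \<Longrightarrow> F z = poly P z / poly Q z"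
    using rational_nearE[OF assms(1)] by metis
  define N where "N = smult (poly Q x) P - smult (poly P x) Q"
  have "poly N x = 0" by (simp add: N_def)
  then obtain T where T: "N = [:-x, 1:] * T" by (auto simp: poly_eq_0_iff_dvd)
  have N_T: "poly N z = (z - x) * poly T z" for z by (simp add: T algebra_simps)
  show ?thesis
  proof (rule that)
    show "(\<lambda>z. poly T z / poly (smult (poly Q x) Q) z) \<in> rational_near X"
      by (rule rational_nearI[of _ "smult (poly Q x) Q" _ T]) (use F assms in auto)
    fix z assume z: "z \<in> X"
    have "(z - x) * (poly T z / poly (smult (poly Q x) Q) z) = poly N z / (poly Q x * poly Q z)"
      by (simp add: N_T)
    also have "\<dots> = F z - F x"
      using F(1)[OF z] F(1)[OF assms(2)] F(2)[of z] F(2)[of x] by (simp add: N_def diff_divide_distrib)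
    finally show "(z - x) * (poly T z / poly (smult (poly Q x) Q) z) = F z - F x" .
  qed
qed

lemma rational_near_differentiable:
  assumes "F \<in> rational_near X" "x \<in> X"
  shows "F field_differentiable at x"
proof -
  obtain P Q where F: "\<And>z. z \<in> X \<Longrightarrow> poly Q z \<noteq> 0" "\<And>z. poly Q z \<noteq> 0 \<Longrightarrow> F z = poly P z / poly Q z"
    using rational_nearE[OF assms(1)] by metis
  have "(\<lambda>z. poly P z / poly Q z) field_differentiable at x"
    using F(1)[OF assms(2)] poly_DERIV field_differentiable_def
    by (intro field_differentiable_divide) blast+
  then obtain D where "((\<lambda>z. poly P z / poly Q z) has_field_derivative D) (at x)"
    unfolding field_differentiable_def by blast
  moreover have "open {z. poly Q z \<noteq> 0}"
    by (intro open_Collect_neq continuous_intros)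
  ultimately have "(F has_field_derivative D) (at x)"
    by (rule has_field_derivative_transform_within_open) (use F assms(2) in auto)
  then show ?thesis unfolding field_differentiable_def by blast
qed

lemma rational_near_continuous: "F \<in> rational_near X \<Longrightarrow> continuous_on X F"
  by (meson continuous_at_imp_continuous_on field_differentiable_imp_continuous_at rational_near_differentiable)

lemma rational_near_measurable:
  assumes "F \<in> rational_near X" "compact X"
  shows "F \<in> borel_measurable (lebesgue_on X)"
  using assms by (intro continuous_imp_measurable_on_sets_lebesgue rational_near_continuous)
    (auto simp: compact_imp_closed borel_closed)

lemma rational_near_bounded:
  assumes "F \<in> rational_near X" "compact X"
  obtains B where "0 < B" "\<And>z. z \<in> X \<Longrightarrow> norm (F z) \<le> B"
  using compact_imp_bounded[OF compact_continuous_image[OF rational_near_continuous[OF assms(1)] assms(2)]]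
  unfolding bounded_pos by auto

lemma rational_near_obtain_rational_off:
  assumes "F \<in> rational_near X" "x \<in> X"
  obtains G where "G \<in> rational_off X" "\<And>z. z \<in> X \<Longrightarrow> G z = F z" "deriv G x = deriv F x"
proof -
  obtain P Q where F: "\<And>z. z \<in> X \<Longrightarrow> poly Q z \<noteq> 0" "\<And>z. poly Q z \<noteq> 0 \<Longrightarrow> F z = poly P z / poly Q z"
    using rational_nearE[OF assms(1)] by metis
  show ?thesis
  proof (rule that)
    show "(\<lambda>z. poly P z / poly Q z) \<in> rational_off X"
      unfolding rational_off_def using F assms by force
    show "poly P z / poly Q z = F z" if "z \<in> X" for z using F that by simp
    have "open {z. poly Q z \<noteq> 0}"
      by (intro open_Collect_neq continuous_intros)
    then have "\<forall>\<^sub>F z in nhds x. z \<in> {z. poly Q z \<noteq> 0}"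
      using F assms by (intro eventually_nhds_in_open) auto
    then show "deriv (\<lambda>z. poly P z / poly Q z) x = deriv F x"
      by (intro deriv_cong_ev) (auto elim: eventually_mono simp: F)
  qed
qed

lemma integrable_bounded_mult:
  fixes F k :: "complex \<Rightarrow> complex"
  assumes "integrable M k" "F \<in> borel_measurable M" "\<And>z. z \<in> space M \<Longrightarrow> norm (F z) \<le> B"
  shows "integrable M (\<lambda>z. F z * k z)"
proof (rule Bochner_Integration.integrable_bound)
  show "integrable M (\<lambda>z. of_real B * k z)" using assms by auto
  show "AE z in M. norm (F z * k z) \<le> norm (of_real B * k z)"
    using assms(3) by (intro AE_I2) (auto simp: norm_mult intro!: mult_right_mono order_trans[OF _ abs_ge_self])
qed (use assms in measurable)

section \<open>The kernel of a bounded point derivation\<close>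

text \<open>The representation of bounded functionals applied to \<open>F \<mapsto> deriv F x0\<close>, which does not vanish at the
  identity function.\<close>

lemma derivation_kernel_exists:
  assumes X: "compact X" "x0 \<in> X" and p: "2 < p"
    and bpd: "has_bounded_point_derivation 1 p X x0"
  shows "\<exists>k\<in>borel_measurable (lebesgue_on X).
           integrable (lebesgue_on X) (\<lambda>z. norm (k z) powr (p / (p - 1))) \<and>
           (\<forall>F\<in>rational_near X. deriv F x0 = (\<integral>z. F z * k z \<partial>lebesgue_on X))"
proof -
  obtain C where C: "\<And>F. F \<in> rational_off X \<Longrightarrow> norm (deriv F x0) \<le> C * Lp_norm p X F"
    using bpd unfolding has_bounded_point_derivation_def by auto
  interpret finite_measure "lebesgue_on X"
    by (intro finite_measure_lebesgue_on lmeasurable_compact X)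
  note diff = rational_near_differentiable[OF _ X(2)]
  show ?thesis
  proof (rule integral_representation_of_bounded_functional[OF p, where C = C])
    fix F assume F: "F \<in> rational_near X"
    show "F \<in> borel_measurable (lebesgue_on X)" by (rule rational_near_measurable[OF F X(1)])
    show "\<exists>B. \<forall>z\<in>space (lebesgue_on X). norm (F z) \<le> B"
      using rational_near_bounded[OF F X(1)] by (metis space_lebesgue_on)
    show "(\<lambda>z. c * F z) \<in> rational_near X" for c
      by (intro rational_near_mult rational_near_const F)
    show "deriv (\<lambda>z. c * F z) x0 = c * deriv F x0" for c
      by (intro deriv_cmult diff F)
    show "norm (deriv F x0) \<le> C * (\<integral>z. norm (F z) powr p \<partial>lebesgue_on X) powr (1 / p)"
    proof -
      obtain G where G: "G \<in> rational_off X" "\<And>z. z \<in> X \<Longrightarrow> G z = F z" "deriv G x0 = deriv F x0"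
        using rational_near_obtain_rational_off[OF F X(2)] by metis
      have "(\<integral>z. norm (G z) powr p \<partial>lebesgue_on X) = (\<integral>z. norm (F z) powr p \<partial>lebesgue_on X)"
        by (rule Bochner_Integration.integral_cong) (use G in auto)
      then show ?thesis using C[OF G(1)] G(3) by (simp add: Lp_norm_def)
    qed
    fix G assume G: "G \<in> rational_near X"
    show "(\<lambda>z. F z + G z) \<in> rational_near X" by (intro rational_near_add F G)
    show "deriv (\<lambda>z. F z + G z) x0 = deriv F x0 + deriv G x0"
      by (intro deriv_add diff F G)
  next
    show "\<exists>F\<in>rational_near X. deriv F x0 \<noteq> 0"
      by (rule bexI[OF _ rational_near_linear[of 0]]) simp
  qed
qed

text \<open>The pairing of \<open>L\<^sup>p\<close> with a kernel in \<open>L\<^sup>q\<close>, where \<open>1 - 1 / p\<close> is the reciprocal of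
  \<open>q = p / (p - 1)\<close>.\<close>

lemma kernel_Lp_pairing:
  assumes X: "compact X" and p: "2 < p" and f: "f \<in> Lp_space p X"
    and \<kappa> [measurable]: "\<kappa> \<in> borel_measurable (lebesgue_on X)"
    and \<kappa>_int: "integrable (lebesgue_on X) (\<lambda>z. norm (\<kappa> z) powr (p / (p - 1)))"
    and F: "F \<in> rational_off X"
  shows "integrable (lebesgue_on X) (\<lambda>z. f z * \<kappa> z)"
    "integrable (lebesgue_on X) (\<lambda>z. norm (F z - f z) powr p)"
    "integrable (lebesgue_on X) (\<lambda>z. norm (F z - f z) * norm (\<kappa> z))"
    "(\<integral>z. norm (F z - f z) * norm (\<kappa> z) \<partial>lebesgue_on X)
      \<le> Lp_norm p X (\<lambda>z. F z - f z) * (\<integral>z. norm (\<kappa> z) powr (p / (p - 1)) \<partial>lebesgue_on X) powr (1 - 1 / p)"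
proof -
  let ?M = "lebesgue_on X"
  interpret finite_measure ?M
    by (intro finite_measure_lebesgue_on lmeasurable_compact X)
  have pq: "1 < p" "1 < p / (p - 1)" "1 / p + 1 / (p / (p - 1)) = 1" "1 / (p / (p - 1)) = 1 - 1 / p"
    using p by (auto simp: field_simps)
  have f': "f \<in> borel_measurable ?M" "integrable ?M (\<lambda>z. norm (f z) powr p)"
    using f by (auto simp: Lp_space_def)
  note [measurable] = f'(1)
  have "integrable ?M (\<lambda>z. norm (f z) * norm (\<kappa> z))"
    by (rule Holder_integral_inequality[OF pq(1-3) f'(1) \<kappa> f'(2) \<kappa>_int])
  then show "integrable ?M (\<lambda>z. f z * \<kappa> z)"
    by (rule Bochner_Integration.integrable_bound) (auto simp: norm_mult)
  have F': "F \<in> rational_near X" by (rule rational_off_subset_near[OF F])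
  have [measurable]: "F \<in> borel_measurable ?M" by (rule rational_near_measurable[OF F' X])
  obtain B where B: "0 < B" "\<And>z. z \<in> X \<Longrightarrow> norm (F z) \<le> B"
    using rational_near_bounded[OF F' X] by blast
  show diff: "integrable ?M (\<lambda>z. norm (F z - f z) powr p)"
  proof (rule Bochner_Integration.integrable_bound)
    show "integrable ?M (\<lambda>z. 2 powr (p - 1) * (B powr p + norm (f z) powr p))" using f' by auto
    have "norm (F z - f z) powr p \<le> 2 powr (p - 1) * (B powr p + norm (f z) powr p)" if "z \<in> X" for z
    proof -
      have "norm (F z - f z) powr p \<le> (B + norm (f z)) powr p"
        using B(2)[OF that] p by (intro powr_mono2 order_trans[OF norm_triangle_ineq4]) auto
      also have "\<dots> \<le> 2 powr (p - 1) * (B powr p + norm (f z) powr p)"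
        using p B by (intro powr_add_le) auto
      finally show ?thesis .
    qed
    then show "AE z in ?M. norm (norm (F z - f z) powr p) \<le> norm (2 powr (p - 1) * (B powr p + norm (f z) powr p))"
      by (intro AE_I2) (auto simp: abs_of_nonneg)
  qed measurable
  have m: "(\<lambda>z. F z - f z) \<in> borel_measurable ?M" by measurable
  show "integrable ?M (\<lambda>z. norm (F z - f z) * norm (\<kappa> z))"
    by (rule Holder_integral_inequality(1)[OF pq(1-3) m \<kappa> diff \<kappa>_int])
  show "(\<integral>z. norm (F z - f z) * norm (\<kappa> z) \<partial>?M)
      \<le> Lp_norm p X (\<lambda>z. F z - f z) * (\<integral>z. norm (\<kappa> z) powr (p / (p - 1)) \<partial>?M) powr (1 - 1 / p)"
    using Holder_integral_inequality(2)[OF pq(1-3) m \<kappa> diff \<kappa>_int] unfolding Lp_norm_def pq(4) .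
qed

lemma Lp_norm_nonneg: "0 \<le> Lp_norm p X f"
  by (simp add: Lp_norm_def)

lemma Rp_approximating_sequence:
  assumes "f \<in> Rp p X"
  obtains F where "\<And>j. F j \<in> rational_off X" "\<And>j. Lp_norm p X (\<lambda>z. F j z - f z) < (1/2) ^ j"
    "(\<lambda>j. Lp_norm p X (\<lambda>z. F j z - f z)) \<longlonglongrightarrow> 0"
proof -
  have "\<exists>G\<in>rational_off X. Lp_norm p X (\<lambda>z. G z - f z) < (1/2) ^ j" for j :: nat
    using assms by (auto simp: Rp_def)
  then obtain F where F: "\<And>j. F j \<in> rational_off X" "\<And>j. Lp_norm p X (\<lambda>z. F j z - f z) < (1/2) ^ j"
    by metis
  have "(\<lambda>j. Lp_norm p X (\<lambda>z. F j z - f z)) \<longlonglongrightarrow> 0"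
    by (rule tendsto_sandwich[OF _ _ tendsto_const LIMSEQ_realpow_zero[of "1/2"]])
       (use less_imp_le[OF F(2)] Lp_norm_nonneg in auto)
  with F show ?thesis by (rule that)
qed

text \<open>A kernel in \<open>L\<^sup>q\<close> that represents a derivation on the rational functions computes its continuous
  extension. This also justifies the definite description in \<^const>\<open>point_derivation\<close>: the limit exists
  by Hoelder's inequality, and it is unique because an approximating sequence exists.\<close>

lemma point_derivation_eq_integral:
  assumes X: "compact X" and p: "2 < p" and f: "f \<in> Rp p X"
    and \<kappa>: "\<kappa> \<in> borel_measurable (lebesgue_on X)"
    and \<kappa>_int: "integrable (lebesgue_on X) (\<lambda>z. norm (\<kappa> z) powr (p / (p - 1)))"
    and rep: "\<And>F. F \<in> rational_off X \<Longrightarrow> (deriv ^^ t) F x0 = (\<integral>z. F z * \<kappa> z \<partial>lebesgue_on X)"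
  shows "point_derivation t p X x0 f = (\<integral>z. f z * \<kappa> z \<partial>lebesgue_on X)"
    and "\<And>F. (\<And>j. F j \<in> rational_off X) \<Longrightarrow> (\<lambda>j. Lp_norm p X (\<lambda>z. F j z - f z)) \<longlonglongrightarrow> 0 \<Longrightarrow>
           (\<lambda>j. (deriv ^^ t) (F j) x0) \<longlonglongrightarrow> (\<integral>z. f z * \<kappa> z \<partial>lebesgue_on X)"
proof -
  let ?M = "lebesgue_on X"
  have fL: "f \<in> Lp_space p X" using f by (simp add: Rp_def)
  note lim = kernel_Lp_pairing[OF X p fL \<kappa> \<kappa>_int]
  show conv: "(\<lambda>j. (deriv ^^ t) (F j) x0) \<longlonglongrightarrow> (\<integral>z. f z * \<kappa> z \<partial>?M)"
    if F: "\<And>j. F j \<in> rational_off X" "(\<lambda>j. Lp_norm p X (\<lambda>z. F j z - f z)) \<longlonglongrightarrow> 0" for F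
  proof (rule Lim_null_comparison[THEN LIM_zero_cancel])
    let ?K = "(\<integral>z. norm (\<kappa> z) powr (p / (p - 1)) \<partial>?M) powr (1 - 1 / p)"
    show "(\<lambda>j. Lp_norm p X (\<lambda>z. F j z - f z) * ?K) \<longlonglongrightarrow> 0"
      by (intro tendsto_mult_left_zero F)
    have "norm ((deriv ^^ t) (F j) x0 - (\<integral>z. f z * \<kappa> z \<partial>?M)) \<le> Lp_norm p X (\<lambda>z. F j z - f z) * ?K" for j
    proof -
      note l = lim[OF F(1)[of j]]
      have m: "(\<lambda>z. (F j z - f z) * \<kappa> z) \<in> borel_measurable ?M"
        using rational_near_measurable[OF rational_off_subset_near[OF F(1)[of j]] X] fL \<kappa>
        by (auto simp: Lp_space_def)
      have i: "integrable ?M (\<lambda>z. (F j z - f z) * \<kappa> z)"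
        by (rule Bochner_Integration.integrable_bound[OF l(3) m]) (auto simp: norm_mult)
      have "integrable ?M (\<lambda>z. (F j z - f z) * \<kappa> z + f z * \<kappa> z)"
        using i l(1) by (rule Bochner_Integration.integrable_add)
      then have "integrable ?M (\<lambda>z. F j z * \<kappa> z)" by (simp add: algebra_simps)
      then have "(deriv ^^ t) (F j) x0 - (\<integral>z. f z * \<kappa> z \<partial>?M) = (\<integral>z. (F j z - f z) * \<kappa> z \<partial>?M)"
        using l(1) rep[OF F(1)] by (simp add: left_diff_distrib)
      also have "norm \<dots> \<le> (\<integral>z. norm ((F j z - f z) * \<kappa> z) \<partial>?M)"
        by (rule integral_norm_bound)
      also have "\<dots> \<le> Lp_norm p X (\<lambda>z. F j z - f z) * ?K"
        using l(4) by (simp add: norm_mult)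
      finally show ?thesis .
    qed
    then show "\<forall>\<^sub>F j in sequentially. norm ((deriv ^^ t) (F j) x0 - (\<integral>z. f z * \<kappa> z \<partial>?M))
        \<le> Lp_norm p X (\<lambda>z. F j z - f z) * ?K" by simp
  qed
  obtain F where F: "\<And>j. F j \<in> rational_off X" "(\<lambda>j. Lp_norm p X (\<lambda>z. F j z - f z)) \<longlonglongrightarrow> 0"
    using Rp_approximating_sequence[OF f] by metis
  show "point_derivation t p X x0 f = (\<integral>z. f z * \<kappa> z \<partial>?M)"
    unfolding point_derivation_def
  proof (rule the_equality)
    fix v assume "\<forall>F. (\<forall>j. F j \<in> rational_off X) \<and> (\<lambda>j. Lp_norm p X (\<lambda>z. F j z - f z)) \<longlonglongrightarrow> 0 \<longrightarrow>
                 (\<lambda>j. (deriv ^^ t) (F j) x0) \<longlonglongrightarrow> v"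
    then have "(\<lambda>j. (deriv ^^ t) (F j) x0) \<longlonglongrightarrow> v" using F by blast
    then show "v = (\<integral>z. f z * \<kappa> z \<partial>?M)" using conv[OF F] by (rule LIMSEQ_unique)
  qed (use conv in blast)
qed

section \<open>Cauchy integrals and potentials of densities\<close>

lemma measurable_ident_lebesgue_on: "(\<lambda>z. z) \<in> borel_measurable (lebesgue_on X)"
  by (rule measurable_restrict_space1) (simp add: measurable_completion)

lemma AE_lebesgue_on_neq:
  fixes x :: complex
  assumes "X \<in> sets lebesgue"
  shows "AE z in lebesgue_on X. z \<noteq> x"
proof -
  have "AE z in lebesgue. z \<noteq> x" using AE_lborel_singleton by (rule AE_completion)
  then show ?thesis using assms by (subst AE_restrict_space_iff) (auto elim: eventually_mono)
qed

text \<open>The measure \<open>h dA\<close> on \<open>X\<close>, restricted to the Borel sets of the plane so that the potential estimates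
  apply to it.\<close>

definition weighted_area :: "complex set \<Rightarrow> (complex \<Rightarrow> real) \<Rightarrow> complex measure" where
  "weighted_area X h = distr (density (lebesgue_on X) (\<lambda>z. ennreal (h z))) borel (\<lambda>z. z)"

context
  fixes X :: "complex set" and h :: "complex \<Rightarrow> real"
  assumes X: "X \<in> sets lebesgue" and h: "integrable (lebesgue_on X) h" and h_nonneg: "\<And>z. 0 \<le> h z"
begin

lemma sets_weighted_area: "sets (weighted_area X h) = sets borel"
  by (simp add: weighted_area_def)

lemma nn_integral_weighted_area:
  assumes "g \<in> borel_measurable borel"
  shows "(\<integral>\<^sup>+z. g z \<partial>weighted_area X h) = (\<integral>\<^sup>+z. ennreal (h z) * g z \<partial>lebesgue_on X)"
proof -
  have [measurable]: "h \<in> borel_measurable (lebesgue_on X)" using h by auto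
  have gm: "g \<in> borel_measurable (lebesgue_on X)"
    using measurable_compose[OF measurable_ident_lebesgue_on assms] by simp
  have "(\<lambda>z. z) \<in> measurable (density (lebesgue_on X) (\<lambda>z. ennreal (h z))) borel"
    using measurable_ident_lebesgue_on by simp
  then show ?thesis
    unfolding weighted_area_def using assms gm
    by (simp add: nn_integral_distr nn_integral_density)
qed

lemma emeasure_weighted_area:
  assumes "A \<in> sets borel"
  shows "emeasure (weighted_area X h) A = (\<integral>\<^sup>+z. ennreal (h z) * indicator A z \<partial>lebesgue_on X)"
  using nn_integral_weighted_area[of "indicator A"] assms sets_weighted_area by simp

lemma finite_measure_weighted_area: "finite_measure (weighted_area X h)"
proof
  have "emeasure (weighted_area X h) UNIV = ennreal (\<integral>z. h z \<partial>lebesgue_on X)"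
    using emeasure_weighted_area[of UNIV] h h_nonneg by (simp add: nn_integral_eq_integral)
  then show "emeasure (weighted_area X h) (space (weighted_area X h)) \<noteq> \<infinity>"
    by (simp add: weighted_area_def)
qed

lemma weighted_area_no_atom: "emeasure (weighted_area X h) {x} = 0"
proof -
  have "emeasure (weighted_area X h) {x} = (\<integral>\<^sup>+z. ennreal (h z) * indicator {x} z \<partial>lebesgue_on X)"
    by (rule emeasure_weighted_area) simp
  also have "\<dots> = (\<integral>\<^sup>+z. 0 \<partial>lebesgue_on X)"
    by (rule nn_integral_cong_AE) (use AE_lebesgue_on_neq[OF X, of x] in eventually_elim, auto)
  finally show ?thesis by simp
qed

text \<open>The potential of \<open>h dA\<close> dominates the Cauchy integrals of all densities bounded by \<open>h\<close>, so that one
  potential controls several Cauchy integrals at once.\<close>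

lemma Cauchy_integral_le_potential:
  fixes g :: "complex \<Rightarrow> complex"
  assumes g: "g \<in> borel_measurable (lebesgue_on X)" and gh: "AE z in lebesgue_on X. norm (g z) \<le> h z"
    and fin: "riesz_potential (weighted_area X h) x \<noteq> \<infinity>"
  shows "integrable (lebesgue_on X) (\<lambda>z. g z / (z - x))"
    and "norm (\<integral>z. g z / (z - x) \<partial>lebesgue_on X) \<le> enn2real (riesz_potential (weighted_area X h) x)"
    and "integrable (lebesgue_on X) (\<lambda>z. h z * inverse (norm (z - x)))"
proof -
  let ?M = "lebesgue_on X"
  note [measurable] = g measurable_ident_lebesgue_on
  have [measurable]: "h \<in> borel_measurable ?M" using h by auto
  have "riesz_potential (weighted_area X h) x = (\<integral>\<^sup>+z. ennreal (h z) * ennreal (inverse (norm (z - x))) \<partial>?M)"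
    unfolding riesz_potential_def by (rule nn_integral_weighted_area) measurable
  also have "\<dots> = (\<integral>\<^sup>+z. ennreal (h z * inverse (norm (z - x))) \<partial>?M)"
    using h_nonneg by (simp add: ennreal_mult)
  finally have eq: "riesz_potential (weighted_area X h) x = (\<integral>\<^sup>+z. ennreal (h z * inverse (norm (z - x))) \<partial>?M)" .
  show dom: "integrable ?M (\<lambda>z. h z * inverse (norm (z - x)))"
    by (rule integrableI_nonneg) (use fin h_nonneg in \<open>auto simp: eq less_top\<close>)
  have le: "AE z in ?M. norm (g z / (z - x)) \<le> h z * inverse (norm (z - x))"
    using gh by eventually_elim
      (simp only: norm_divide, simp only: divide_inverse, rule mult_right_mono, simp_all)
  show int: "integrable ?M (\<lambda>z. g z / (z - x))"
    by (rule Bochner_Integration.integrable_bound[OF dom])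
       (measurable, use le in eventually_elim, use h_nonneg in auto)
  have "norm (\<integral>z. g z / (z - x) \<partial>?M) \<le> (\<integral>z. norm (g z / (z - x)) \<partial>?M)"
    by (rule integral_norm_bound)
  also have "\<dots> \<le> (\<integral>z. h z * inverse (norm (z - x)) \<partial>?M)"
    by (rule integral_mono_AE[OF integrable_norm[OF int] dom le])
  also have "\<dots> = enn2real (riesz_potential (weighted_area X h) x)"
    unfolding eq using dom h_nonneg by (subst integral_eq_nn_integral) auto
  finally show "norm (\<integral>z. g z / (z - x) \<partial>?M) \<le> enn2real (riesz_potential (weighted_area X h) x)" .
qed

end

section \<open>The Cauchy transform of the kernel\<close>

context
  fixes X :: "complex set" and x0 :: complex and k :: "complex \<Rightarrow> complex"
  assumes X: "compact X" and x0: "x0 \<in> X"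
    and k: "integrable (lebesgue_on X) k"
    and rep: "\<And>F. F \<in> rational_near X \<Longrightarrow> deriv F x0 = (\<integral>z. F z * k z \<partial>lebesgue_on X)"
begin

lemma integrable_rational_kernel: "F \<in> rational_near X \<Longrightarrow> integrable (lebesgue_on X) (\<lambda>z. F z * k z)"
  by (metis X integrable_bounded_mult k rational_near_bounded rational_near_measurable space_lebesgue_on)

text \<open>The product rule at \<open>x0\<close>: multiplication by \<open>z - x0\<close> turns the kernel of the derivation into a kernel of
  the evaluation, and multiplication by \<open>(z - x0)\<^sup>2\<close> into an annihilating one.\<close>

lemma kernel_evaluates:
  assumes F: "F \<in> rational_near X"
  shows "(\<integral>z. F z * (z - x0) * k z \<partial>lebesgue_on X) = F x0"
    and "(\<integral>z. F z * (z - x0) * (z - x0) * k z \<partial>lebesgue_on X) = 0"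
proof -
  note D = rational_near_differentiable[OF _ x0]
  have G: "(\<lambda>z. F z * (z - x0)) \<in> rational_near X"
    by (intro rational_near_mult rational_near_linear F)
  have G2: "(\<lambda>z. F z * (z - x0) * (z - x0)) \<in> rational_near X"
    by (intro rational_near_mult rational_near_linear F)
  have "deriv (\<lambda>z. F z * (z - x0)) x0 = F x0"
    by (subst deriv_mult) (auto intro!: D F rational_near_linear)
  then show "(\<integral>z. F z * (z - x0) * k z \<partial>lebesgue_on X) = F x0" using rep[OF G] by simp
  have "deriv (\<lambda>z. F z * (z - x0) * (z - x0)) x0 = 0"
    by (subst deriv_mult) (auto intro!: D G rational_near_linear)
  then show "(\<integral>z. F z * (z - x0) * (z - x0) * k z \<partial>lebesgue_on X) = 0" using rep[OF G2] by simp
qed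

text \<open>For \<open>x \<notin> X\<close> the function \<open>1 / (z - x)\<close> is itself rational with pole off \<open>X\<close>. Expand
  \<open>(z - x0)\<^sup>2 / (z - x) = (z - x0) + (x - x0) + (x - x0)\<^sup>2 / (z - x)\<close> and integrate against \<open>k\<close>: the left side
  gives \<open>0\<close>, and the first two terms on the right give \<open>1\<close> and \<open>0\<close>. Consequently the Cauchy transform of
  \<open>k\<close> is as large as \<open>1 / (x - x0)\<^sup>2\<close> off \<open>X\<close>, which forces \<open>X\<close> to have full density at \<open>x0\<close>.\<close>

lemma Cauchy_transform_outside:
  assumes x: "x \<notin> X"
  shows "1 + (x - x0)\<^sup>2 * (\<integral>z. k z / (z - x) \<partial>lebesgue_on X) = 0"
proof -
  let ?M = "lebesgue_on X"
  have inv: "(\<lambda>z. inverse (z - x)) \<in> rational_near X" by (rule rational_near_inverse[OF x])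
  have one: "(\<lambda>z. 1) \<in> rational_near X" by (rule rational_near_const)
  have lin: "(\<lambda>z. z - x0) \<in> rational_near X" by (rule rational_near_linear)
  have i1: "integrable ?M (\<lambda>z. (z - x0) * k z)" "integrable ?M (\<lambda>z. inverse (z - x) * k z)"
    by (rule integrable_rational_kernel[OF lin], rule integrable_rational_kernel[OF inv])
  have "0 = (\<integral>z. inverse (z - x) * (z - x0) * (z - x0) * k z \<partial>?M)"
    by (rule kernel_evaluates(2)[OF inv, symmetric])
  also have "\<dots> = (\<integral>z. (z - x0) * k z + (x - x0) * k z + (x - x0)\<^sup>2 * (inverse (z - x) * k z) \<partial>?M)"
  proof (rule Bochner_Integration.integral_cong[OF refl])
    fix z assume "z \<in> space ?M"
    then have "z - x \<noteq> 0" using x by auto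
    then show "inverse (z - x) * (z - x0) * (z - x0) * k z
        = (z - x0) * k z + (x - x0) * k z + (x - x0)\<^sup>2 * (inverse (z - x) * k z)"
      by (simp add: field_simps power2_eq_square)
  qed
  also have "\<dots> = (\<integral>z. (z - x0) * k z \<partial>?M) + (x - x0) * (\<integral>z. k z \<partial>?M)
      + (x - x0)\<^sup>2 * (\<integral>z. inverse (z - x) * k z \<partial>?M)"
    using i1 k by simp
  also have "(\<integral>z. (z - x0) * k z \<partial>?M) = 1" using kernel_evaluates(1)[OF one] by simp
  also have "(\<integral>z. k z \<partial>?M) = 0" using rep[OF one] by simp
  finally show ?thesis by (simp add: divide_inverse mult.commute)
qed

text \<open>The same expansion for the difference quotient \<open>R\<close> of \<open>F\<close> at \<open>x\<close>, whose singularity is removable: since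
  \<open>(z - x0)\<^sup>2 * k\<close> annihilates \<open>R\<close>, the value of \<open>F\<close> at \<open>x\<close> is expressed by its first order Taylor
  polynomial at \<open>x0\<close> and two Cauchy integrals with the small factor \<open>(x - x0)\<^sup>2\<close>.\<close>

lemma Cauchy_transform_identity:
  assumes F: "F \<in> rational_near X" and x: "x \<in> X"
    and kx: "integrable (lebesgue_on X) (\<lambda>z. k z / (z - x))"
  shows "F x * (1 + (x - x0)\<^sup>2 * (\<integral>z. k z / (z - x) \<partial>lebesgue_on X))
     = F x0 + (x - x0) * deriv F x0 + (x - x0)\<^sup>2 * (\<integral>z. F z * k z / (z - x) \<partial>lebesgue_on X)"
proof -
  let ?M = "lebesgue_on X"
  have one: "(\<lambda>z. 1) \<in> rational_near X" by (rule rational_near_const)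
  have lin: "(\<lambda>z. z - x0) \<in> rational_near X" by (rule rational_near_linear)
  have Flin: "(\<lambda>z. F z * (z - x0)) \<in> rational_near X" by (intro rational_near_mult F lin)
  obtain B where B: "0 < B" "\<And>z. z \<in> X \<Longrightarrow> norm (F z) \<le> B"
    using rational_near_bounded[OF F X] by blast
  have Fkx: "integrable ?M (\<lambda>z. F z * (k z / (z - x)))"
    by (rule integrable_bounded_mult[OF kx rational_near_measurable[OF F X], of B]) (use B in auto)
  obtain R where R: "R \<in> rational_near X" "\<And>z. z \<in> X \<Longrightarrow> (z - x) * R z = F z - F x"
    using rational_near_difference_quotient[OF F x] by blast
  have sum6: "(\<integral>z. a z + c2 * b z - c3 * c z - c4 * d z + c5 * e z - c6 * g z \<partial>?M)
      = (\<integral>z. a z \<partial>?M) + c2 * (\<integral>z. b z \<partial>?M) - c3 * (\<integral>z. c z \<partial>?M) - c4 * (\<integral>z. d z \<partial>?M)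
        + c5 * (\<integral>z. e z \<partial>?M) - c6 * (\<integral>z. g z \<partial>?M)"
    if "integrable ?M a" "integrable ?M b" "integrable ?M c" "integrable ?M d" "integrable ?M e"
      "integrable ?M g"
    for a b c d e g :: "complex \<Rightarrow> complex" and c2 c3 c4 c5 c6
    using that by simp
  note i = integrable_rational_kernel[OF F] integrable_rational_kernel[OF Flin]
    integrable_rational_kernel[OF lin] k kx Fkx
  have "0 = (\<integral>z. R z * (z - x0) * (z - x0) * k z \<partial>?M)"
    by (rule kernel_evaluates(2)[OF R(1), symmetric])
  also have "\<dots> = (\<integral>z. F z * (z - x0) * k z + (x - x0) * (F z * k z) - F x * ((z - x0) * k z)
        - F x * (x - x0) * k z + (x - x0)\<^sup>2 * (F z * (k z / (z - x)))
        - (x - x0)\<^sup>2 * F x * (k z / (z - x)) \<partial>?M)"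
  proof (rule integral_cong_AE)
    have "AE z in ?M. z \<noteq> x" "AE z in ?M. z \<in> X"
      using AE_lebesgue_on_neq compact_imp_closed[OF X] AE_space[of ?M]
      by (auto simp: borel_closed)
    then show "AE z in ?M. R z * (z - x0) * (z - x0) * k z =
        F z * (z - x0) * k z + (x - x0) * (F z * k z) - F x * ((z - x0) * k z)
        - F x * (x - x0) * k z + (x - x0)\<^sup>2 * (F z * (k z / (z - x)))
        - (x - x0)\<^sup>2 * F x * (k z / (z - x))"
    proof eventually_elim
      case (elim z)
      then have Rz: "R z = (F z - F x) / (z - x)" using R(2)[of z] by (simp add: field_simps)
      have "(z - x0) * (z - x0) = (z - x) * (z - x0 + (x - x0)) + (x - x0)\<^sup>2"
        by (simp add: algebra_simps power2_eq_square)
      then have "R z * k z * ((z - x0) * (z - x0))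
          = R z * k z * ((z - x) * (z - x0 + (x - x0)) + (x - x0)\<^sup>2)" by simp
      then have "R z * (z - x0) * (z - x0) * k z
          = ((z - x) * R z) * (z - x0 + (x - x0)) * k z + (x - x0)\<^sup>2 * (R z * k z)"
        by (simp only: distrib_left mult_ac)
      also have "(z - x) * R z = F z - F x" using R(2) elim by blast
      also have "(x - x0)\<^sup>2 * (R z * k z)
          = (x - x0)\<^sup>2 * (F z * (k z / (z - x))) - (x - x0)\<^sup>2 * F x * (k z / (z - x))"
        unfolding Rz by (simp add: diff_divide_distrib algebra_simps)
      finally show ?case by (simp add: algebra_simps)
    qed
    show "(\<lambda>z. R z * (z - x0) * (z - x0) * k z) \<in> borel_measurable ?M"
      using integrable_rational_kernel[OF rational_near_mult[OF rational_near_mult[OF R(1) lin] lin]]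
      by (rule borel_measurable_integrable)
  qed (use i in measurable)
  also have "\<dots> = (\<integral>z. F z * (z - x0) * k z \<partial>?M) + (x - x0) * (\<integral>z. F z * k z \<partial>?M)
      - F x * (\<integral>z. (z - x0) * k z \<partial>?M) - F x * (x - x0) * (\<integral>z. k z \<partial>?M)
      + (x - x0)\<^sup>2 * (\<integral>z. F z * (k z / (z - x)) \<partial>?M) - (x - x0)\<^sup>2 * F x * (\<integral>z. k z / (z - x) \<partial>?M)"
    by (rule sum6) (rule i)+
  also have "(\<integral>z. F z * (z - x0) * k z \<partial>?M) = F x0" by (rule kernel_evaluates(1)[OF F])
  also have "(\<integral>z. F z * k z \<partial>?M) = deriv F x0" by (rule rep[OF F, symmetric])
  also have "(\<integral>z. (z - x0) * k z \<partial>?M) = 1" using kernel_evaluates(1)[OF one] by simp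
  also have "(\<integral>z. k z \<partial>?M) = 0" using rep[OF one] by simp
  finally show ?thesis by (simp add: algebra_simps)
qed

end

text \<open>The identity passes to the limit along rational functions \<open>F j\<close> converging to \<open>f\<close> so fast that they
  converge almost everywhere and that \<open>\<Sum>j. norm (F j - f) * norm k\<close> is integrable. The density \<open>h\<close>
  contains this sum, so it dominates all \<open>F j * k\<close>; at every point where the potential of \<open>h dA\<close> is finite
  the Cauchy integrals of \<open>F j * k\<close> therefore converge by dominated convergence.\<close>

lemma Cauchy_transform_identity_Rp:
  fixes f k :: "complex \<Rightarrow> complex" and p :: real
  assumes X: "compact X" and x0: "x0 \<in> X" and p: "2 < p" and f: "f \<in> Rp p X"
    and k_meas: "k \<in> borel_measurable (lebesgue_on X)"
    and k_int: "integrable (lebesgue_on X) (\<lambda>z. norm (k z) powr (p / (p - 1)))"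
    and rep: "\<And>F. F \<in> rational_near X \<Longrightarrow> deriv F x0 = (\<integral>z. F z * k z \<partial>lebesgue_on X)"
  defines "f0 \<equiv> point_derivation 0 p X x0 f" and "f1 \<equiv> point_derivation 1 p X x0 f"
  obtains h where "integrable (lebesgue_on X) h" "\<And>z. 0 \<le> h z"
    "AE z in lebesgue_on X. norm (k z) \<le> h z" "AE z in lebesgue_on X. norm (f z * k z) \<le> h z"
    "AE x in lebesgue_on X. riesz_potential (weighted_area X h) x \<noteq> \<infinity> \<longrightarrow>
       f x * (1 + (x - x0)\<^sup>2 * (\<integral>z. k z / (z - x) \<partial>lebesgue_on X))
     = f0 + (x - x0) * f1 + (x - x0)\<^sup>2 * (\<integral>z. f z * k z / (z - x) \<partial>lebesgue_on X)"
proof -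
  let ?M = "lebesgue_on X" and ?q = "p / (p - 1)"
  have X_meas: "X \<in> sets lebesgue" using X by (auto simp: compact_imp_closed borel_closed)
  interpret finite_measure ?M
    by (intro finite_measure_lebesgue_on lmeasurable_compact X)
  note [measurable] = k_meas
  have fL: "f \<in> Lp_space p X" using f by (simp add: Rp_def)
  then have [measurable]: "f \<in> borel_measurable ?M" by (simp add: Lp_space_def)
  have one: "(\<lambda>z. 1) \<in> rational_off X"
    unfolding rational_off_def by (rule CollectI, rule exI[of _ 1], rule exI[of _ 1]) auto
  have k: "integrable ?M k"
  proof -
    have "(\<lambda>z. 1) \<in> Lp_space p X" by (simp add: Lp_space_def)
    from kernel_Lp_pairing(1)[OF X p this k_meas k_int one] show ?thesis by simp
  qed
  \<comment> \<open>the kernel of the evaluation at \<open>x0\<close>\<close>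
  define \<kappa> where "\<kappa> z = (z - x0) * k z" for z
  have lin: "(\<lambda>z. z - x0) \<in> rational_near X" by (rule rational_near_linear)
  obtain B where B: "0 < B" "\<And>z. z \<in> X \<Longrightarrow> norm (z - x0) \<le> B"
    using rational_near_bounded[OF lin X] by blast
  have \<kappa>_meas [measurable]: "\<kappa> \<in> borel_measurable ?M"
    unfolding \<kappa>_def using rational_near_measurable[OF lin X] by measurable
  have \<kappa>_int: "integrable ?M (\<lambda>z. norm (\<kappa> z) powr ?q)"
  proof (rule Bochner_Integration.integrable_bound)
    show "integrable ?M (\<lambda>z. B powr ?q * norm (k z) powr ?q)" using k_int by simp
    show "AE z in ?M. norm (norm (\<kappa> z) powr ?q) \<le> norm (B powr ?q * norm (k z) powr ?q)"
      using B p by (intro AE_I2) (auto simp: \<kappa>_def norm_mult powr_mult intro!: mult_right_mono powr_mono2)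
  qed measurable
  have rep0: "(deriv ^^ 0) F x0 = (\<integral>z. F z * \<kappa> z \<partial>?M)" if "F \<in> rational_off X" for F
    using kernel_evaluates(1)[OF X x0 k rep rational_off_subset_near[OF that]]
    by (simp add: \<kappa>_def mult.assoc)
  have rep1: "(deriv ^^ 1) F x0 = (\<integral>z. F z * k z \<partial>?M)" if "F \<in> rational_off X" for F
    using rep[OF rational_off_subset_near[OF that]] by simp
  obtain F where F: "\<And>j. F j \<in> rational_off X" "\<And>j. Lp_norm p X (\<lambda>z. F j z - f z) < (1/2) ^ j"
    "(\<lambda>j. Lp_norm p X (\<lambda>z. F j z - f z)) \<longlonglongrightarrow> 0"
    using Rp_approximating_sequence[OF f] that by blast
  note Fn = rational_off_subset_near[OF F(1)]
  have [measurable]: "F j \<in> borel_measurable ?M" for j by (rule rational_near_measurable[OF Fn X])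
  note lims = kernel_Lp_pairing[OF X p fL k_meas k_int F(1)]
  have F0: "(\<lambda>j. F j x0) \<longlonglongrightarrow> f0"
  proof -
    have "point_derivation 0 p X x0 f = (\<integral>z. f z * \<kappa> z \<partial>?M)"
      by (rule point_derivation_eq_integral(1)[OF X p f \<kappa>_meas \<kappa>_int]) (rule rep0)
    moreover have "(\<lambda>j. (deriv ^^ 0) (F j) x0) \<longlonglongrightarrow> (\<integral>z. f z * \<kappa> z \<partial>?M)"
      by (rule point_derivation_eq_integral(2)[OF X p f \<kappa>_meas \<kappa>_int _ F(1) F(3)]) (rule rep0)
    ultimately show ?thesis by (simp add: f0_def)
  qed
  have F1: "(\<lambda>j. deriv (F j) x0) \<longlonglongrightarrow> f1"
  proof -
    have "point_derivation 1 p X x0 f = (\<integral>z. f z * k z \<partial>?M)"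
      by (rule point_derivation_eq_integral(1)[OF X p f k_meas k_int]) (rule rep1)
    moreover have "(\<lambda>j. (deriv ^^ 1) (F j) x0) \<longlonglongrightarrow> (\<integral>z. f z * k z \<partial>?M)"
      by (rule point_derivation_eq_integral(2)[OF X p f k_meas k_int _ F(1) F(3)]) (rule rep1)
    ultimately show ?thesis by (simp add: f1_def)
  qed

  have ptw: "AE z in ?M. (\<lambda>j. F j z) \<longlonglongrightarrow> f z"
  proof -
    have "AE z in ?M. summable (\<lambda>j. norm (F j z - f z) powr p)"
    proof (rule AE_summable_of_summable_integral)
      show "summable (\<lambda>j. \<integral>z. norm (F j z - f z) powr p \<partial>?M)"
      proof (rule summable_comparison_test')
        show "summable (\<lambda>j. (1/2::real) ^ j)" by (rule summable_geometric) simp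
        fix j
        let ?N = "\<integral>z. norm (F j z - f z) powr p \<partial>?M"
        have N: "0 \<le> ?N" by (intro integral_nonneg_AE) auto
        have "?N = Lp_norm p X (\<lambda>z. F j z - f z) powr p"
          using N p by (simp add: Lp_norm_def powr_powr)
        also have "\<dots> \<le> ((1/2) ^ j) powr p"
          using p F(2)[of j] Lp_norm_nonneg by (intro powr_mono2) auto
        also have "\<dots> \<le> ((1/2) ^ j) powr 1"
          using p by (intro powr_mono') (auto simp: power_le_one)
        finally show "norm ?N \<le> (1/2) ^ j" using N by simp
      qed
    qed (use lims in auto)
    then show ?thesis
    proof eventually_elim
      case (elim z)
      have "(\<lambda>j. (norm (F j z - f z) powr p) powr (1 / p)) \<longlonglongrightarrow> 0 powr (1 / p)"
        using p summable_LIMSEQ_zero[OF elim] by (intro tendsto_powr') auto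
      then have "(\<lambda>j. norm (F j z - f z)) \<longlonglongrightarrow> 0" using p by (simp add: powr_powr)
      then show ?case by (simp add: tendsto_norm_zero_iff LIM_zero_cancel)
    qed
  qed

  define K where "K = (\<integral>z. norm (k z) powr ?q \<partial>?M) powr (1 - 1 / p)"
  define u where "u j z = norm (F j z - f z) * norm (k z)" for j z
  have u_int: "integrable ?M (u j)" for j unfolding u_def by (rule lims(3))
  have u_nonneg: "0 \<le> u j z" for j z by (simp add: u_def)
  have u_sum: "summable (\<lambda>j. \<integral>z. u j z \<partial>?M)"
  proof (rule summable_comparison_test')
    show "summable (\<lambda>j. (1/2::real) ^ j * K)" by (intro summable_mult2 summable_geometric) simp
    fix j
    have "(\<integral>z. u j z \<partial>?M) \<le> Lp_norm p X (\<lambda>z. F j z - f z) * K"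
      unfolding u_def K_def by (rule lims(4))
    also have "\<dots> \<le> (1/2) ^ j * K"
      using F(2)[of j] by (intro mult_right_mono) (auto simp: K_def)
    finally show "norm (\<integral>z. u j z \<partial>?M) \<le> (1/2) ^ j * K"
      using integral_nonneg_AE[of "u j" ?M] u_nonneg by simp
  qed
  have u_ae: "AE z in ?M. summable (\<lambda>j. u j z)"
    by (rule AE_summable_of_summable_integral[OF u_int u_nonneg u_sum])
  have U_int: "integrable ?M (\<lambda>z. \<Sum>j. u j z)"
    by (rule integrable_suminf) (use u_int u_nonneg u_sum u_ae in auto)
  define h where "h z = norm (k z) + norm (f z * k z) + \<bar>\<Sum>j. u j z\<bar>" for z
  have h_int: "integrable ?M h" unfolding h_def using k lims(1) U_int by auto
  have h_nonneg: "0 \<le> h z" for z by (simp add: h_def)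
  have kh: "AE z in ?M. norm (k z) \<le> h z" and fkh: "AE z in ?M. norm (f z * k z) \<le> h z"
    by (auto simp: h_def)
  have Fkh: "AE z in ?M. norm (F j z * k z) \<le> h z" for j
    using u_ae
  proof eventually_elim
    case (elim z)
    have "F j z * k z = f z * k z + (F j z - f z) * k z" by (simp add: algebra_simps)
    then have "norm (F j z * k z) \<le> norm (f z * k z) + norm ((F j z - f z) * k z)"
      by (metis norm_triangle_ineq)
    also have "norm ((F j z - f z) * k z) = u j z" by (simp add: u_def norm_mult)
    also have "u j z \<le> (\<Sum>j. u j z)"
      using sum_le_suminf[OF elim, of "{j}"] u_nonneg by auto
    finally show ?case unfolding h_def
      using norm_ge_zero[of "k z"] abs_ge_self[of "\<Sum>j. u j z"] by linarith
  qed
  note pot = Cauchy_integral_le_potential[OF X_meas h_int h_nonneg]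
  have "AE x in ?M. riesz_potential (weighted_area X h) x \<noteq> \<infinity> \<longrightarrow>
       f x * (1 + (x - x0)\<^sup>2 * (\<integral>z. k z / (z - x) \<partial>?M))
     = f0 + (x - x0) * f1 + (x - x0)\<^sup>2 * (\<integral>z. f z * k z / (z - x) \<partial>?M)"
    using ptw AE_space
  proof (eventually_elim, intro impI)
    fix x assume Fx: "(\<lambda>j. F j x) \<longlonglongrightarrow> f x" and "x \<in> space ?M"
      and fin: "riesz_potential (weighted_area X h) x \<noteq> \<infinity>"
    then have x: "x \<in> X" by simp
    let ?k = "\<integral>z. k z / (z - x) \<partial>?M"
    note [measurable] = measurable_ident_lebesgue_on
    have "(\<lambda>j. \<integral>z. F j z * k z / (z - x) \<partial>?M) \<longlonglongrightarrow> (\<integral>z. f z * k z / (z - x) \<partial>?M)"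
    proof (rule integral_dominated_convergence)
      show "integrable ?M (\<lambda>z. h z * inverse (norm (z - x)))"
        by (rule pot(3)[OF k_meas kh fin])
      show "AE z in ?M. (\<lambda>j. F j z * k z / (z - x)) \<longlonglongrightarrow> f z * k z / (z - x)"
        using ptw by eventually_elim (simp only: divide_inverse, intro tendsto_mult_right, assumption)
      show "AE z in ?M. norm (F j z * k z / (z - x)) \<le> h z * inverse (norm (z - x))" for j
        using Fkh[of j] by eventually_elim
          (simp only: norm_divide, simp only: divide_inverse, rule mult_right_mono, simp_all)
    qed measurable
    then have "(\<lambda>j. F j x0 + (x - x0) * deriv (F j) x0 + (x - x0)\<^sup>2 * (\<integral>z. F j z * k z / (z - x) \<partial>?M))
        \<longlonglongrightarrow> f0 + (x - x0) * f1 + (x - x0)\<^sup>2 * (\<integral>z. f z * k z / (z - x) \<partial>?M)"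
      by (intro tendsto_add tendsto_mult_left F0 F1)
    moreover have "F j x * (1 + (x - x0)\<^sup>2 * ?k)
        = F j x0 + (x - x0) * deriv (F j) x0 + (x - x0)\<^sup>2 * (\<integral>z. F j z * k z / (z - x) \<partial>?M)" for j
      by (rule Cauchy_transform_identity[OF X x0 k rep Fn x pot(1)[OF k_meas kh fin]])
    ultimately have "(\<lambda>j. F j x * (1 + (x - x0)\<^sup>2 * ?k))
        \<longlonglongrightarrow> f0 + (x - x0) * f1 + (x - x0)\<^sup>2 * (\<integral>z. f z * k z / (z - x) \<partial>?M)" by simp
    moreover have "(\<lambda>j. F j x * (1 + (x - x0)\<^sup>2 * ?k)) \<longlonglongrightarrow> f x * (1 + (x - x0)\<^sup>2 * ?k)"
      by (intro tendsto_mult_right Fx)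
    ultimately show "f x * (1 + (x - x0)\<^sup>2 * ?k)
        = f0 + (x - x0) * f1 + (x - x0)\<^sup>2 * (\<integral>z. f z * k z / (z - x) \<partial>?M)"
      by (rule LIMSEQ_unique[symmetric])
  qed
  then show ?thesis by (rule that[OF h_int h_nonneg kh fkh])
qed

section \<open>Approximate differentiability\<close>

text \<open>Full density depends only on the germ of the set at \<open>x0\<close> and ignores null sets, so it is
  inherited by a set that contains \<open>S\<close> only locally and almost everywhere.\<close>

lemma full_area_density_superset:
  assumes S: "full_area_density S x0" and N: "N \<in> null_sets lebesgue"
    and E: "E \<in> sets lebesgue" and \<delta>: "0 < \<delta>" "ball x0 \<delta> \<inter> S - N \<subseteq> E"
  shows "full_area_density E x0"
  unfolding full_area_density_def
proof (intro conjI E)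
  let ?B = "\<lambda>n::nat. ball x0 (1 / real n)"
  have S_meas: "S \<in> sets lebesgue" and
    S_lim: "(\<lambda>n. measure lebesgue (?B n - S) / measure lebesgue (?B n)) \<longlonglongrightarrow> 0"
    using S by (auto simp: full_area_density_def)
  have le: "measure lebesgue (?B n - E) \<le> measure lebesgue (?B n - S)" if "1 / real n < \<delta>" for n
  proof -
    have fm: "?B n - S \<in> fmeasurable lebesgue"
      using S_meas by (intro fmeasurable_Diff) auto
    have "measure lebesgue (?B n - E) \<le> measure lebesgue ((?B n - S) \<union> N)"
    proof (rule measure_mono_fmeasurable)
      show "?B n - E \<subseteq> (?B n - S) \<union> N" using \<delta> that by (force simp: subset_eq)
      show "(?B n - S) \<union> N \<in> fmeasurable lebesgue"
        using N by (intro fmeasurable.Un fm) (auto intro: null_setsD1 fmeasurableI_null_sets)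
    qed (use E in auto)
    also have "\<dots> = measure lebesgue (?B n - S)"
      using fm N by (intro measure_Un_null_set) auto
    finally show ?thesis .
  qed
  have "(\<lambda>n. 1 / real n) \<longlonglongrightarrow> 0" by (rule lim_1_over_n)
  then have "\<forall>\<^sub>F n in sequentially. 1 / real n < \<delta>" using \<delta> by (intro order_tendstoD)
  then have "\<forall>\<^sub>F n in sequentially. measure lebesgue (?B n - E) / measure lebesgue (?B n)
      \<le> measure lebesgue (?B n - S) / measure lebesgue (?B n)"
    by eventually_elim (intro divide_right_mono le, auto)
  then show "(\<lambda>n. measure lebesgue (?B n - E) / measure lebesgue (?B n)) \<longlonglongrightarrow> 0"
    by (intro tendsto_sandwich[OF _ _ tendsto_const S_lim]) auto
qed

theorem theorem1p1:
  fixes X :: "complex set" and x0 :: complex and p :: real and f :: "complex \<Rightarrow> complex"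
  assumes "compact X" and "interior X = {}" and "x0 \<in> X" and "2 < p"
    and "has_bounded_point_derivation 1 p X x0"
    and "f \<in> Rp p X"
  shows "\<exists>E\<subseteq>X. full_area_density E x0 \<and>
    ((\<lambda>x. norm ((f x - point_derivation 0 p X x0 f) / (x - x0) - point_derivation 1 p X x0 f))
       \<longlongrightarrow> 0) (at x0 within E)"
proof -
  let ?M = "lebesgue_on X"
  note X = \<open>compact X\<close> and x0 = \<open>x0 \<in> X\<close> and p = \<open>2 < p\<close>
  have X_meas: "X \<in> sets lebesgue" using X by (auto simp: compact_imp_closed borel_closed)
  define f0 where "f0 = point_derivation 0 p X x0 f"
  define f1 where "f1 = point_derivation 1 p X x0 f"
  obtain k where k_meas: "k \<in> borel_measurable ?M"
    and k_int: "integrable ?M (\<lambda>z. norm (k z) powr (p / (p - 1)))"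
    and rep: "\<And>F. F \<in> rational_near X \<Longrightarrow> deriv F x0 = (\<integral>z. F z * k z \<partial>?M)"
    using derivation_kernel_exists[OF X x0 p assms(5)] by blast
  define \<kappa> where "\<kappa> x = (\<integral>z. k z / (z - x) \<partial>?M)" for x
  define \<phi> where "\<phi> x = (\<integral>z. f z * k z / (z - x) \<partial>?M)" for x
  obtain h where h: "integrable ?M h" "\<And>z. 0 \<le> h z"
    and kh: "AE z in ?M. norm (k z) \<le> h z" and fkh: "AE z in ?M. norm (f z * k z) \<le> h z"
    and id: "AE x in ?M. riesz_potential (weighted_area X h) x \<noteq> \<infinity> \<longrightarrow>
       f x * (1 + (x - x0)\<^sup>2 * \<kappa> x) = f0 + (x - x0) * f1 + (x - x0)\<^sup>2 * \<phi> x"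
    unfolding f0_def f1_def \<kappa>_def \<phi>_def
    using Cauchy_transform_identity_Rp[OF X x0 p assms(6) k_meas k_int rep] by blast
  define \<nu> where "\<nu> = weighted_area X h"
  have \<nu>: "finite_measure \<nu>" "sets \<nu> = sets borel" "emeasure \<nu> {x0} = 0"
    unfolding \<nu>_def using X_meas h
    by (auto simp: finite_measure_weighted_area sets_weighted_area weighted_area_no_atom)
  have k: "integrable ?M k"
    by (rule Bochner_Integration.integrable_bound[OF h(1) k_meas]) (use kh in eventually_elim, use h in auto)
  have fk_meas: "(\<lambda>z. f z * k z) \<in> borel_measurable ?M"
    using k_meas assms(6) by (auto simp: Rp_def Lp_space_def)

  \<comment> \<open>Along \<open>S\<close> the potential is small compared with the reciprocal distance to \<open>x0\<close>.\<close>
  define Q where "Q x = ennreal (norm (x - x0)) * riesz_potential \<nu> x" for x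
  have [measurable]: "riesz_potential \<nu> \<in> borel_measurable borel"
    by (rule measurable_riesz_potential[OF \<nu>(1,2)])
  have "Q \<in> borel_measurable borel" unfolding Q_def by measurable
  moreover have "(\<lambda>n. ennreal (1 / (1 / 2 ^ n)\<^sup>2) * (\<integral>\<^sup>+x\<in>ball x0 (1 / 2 ^ n). Q x \<partial>lborel)) \<longlonglongrightarrow> 0"
  proof -
    have "(\<lambda>n. 1 / 2 ^ n :: real) \<longlonglongrightarrow> 0"
      using LIMSEQ_realpow_zero[of "1/2::real"] by (simp add: power_one_over)
    then show ?thesis unfolding Q_def by (intro riesz_potential_average_tendsto_0 \<nu>) auto
  qed
  ultimately obtain S where S: "S \<in> sets borel" "full_area_density S x0" "(Q \<longlongrightarrow> 0) (at x0 within S)"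
    using full_density_limit_of_average_tendsto_0 by blast
  define s where "s x = norm (x - x0) * enn2real (riesz_potential \<nu> x)" for x
  have s_lim: "(s \<longlongrightarrow> 0) (at x0 within S)"
    using tendsto_enn2real[where l=0, simplified, OF S(3)] unfolding Q_def s_def by (simp add: enn2real_mult)

  have "AE x in lebesgue. riesz_potential \<nu> x \<noteq> \<infinity>"
    by (rule AE_completion[OF AE_riesz_potential_finite[OF \<nu>(1,2)]])
  moreover have "AE x in lebesgue. x \<in> X \<longrightarrow> riesz_potential \<nu> x \<noteq> \<infinity> \<longrightarrow>
       f x * (1 + (x - x0)\<^sup>2 * \<kappa> x) = f0 + (x - x0) * f1 + (x - x0)\<^sup>2 * \<phi> x"
    using id X_meas unfolding \<nu>_def by (subst (asm) AE_restrict_space_iff) auto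
  ultimately have "AE x in lebesgue. riesz_potential \<nu> x \<noteq> \<infinity> \<and> (x \<in> X \<longrightarrow>
       f x * (1 + (x - x0)\<^sup>2 * \<kappa> x) = f0 + (x - x0) * f1 + (x - x0)\<^sup>2 * \<phi> x)"
    by eventually_elim auto
  then obtain N where N: "N \<in> null_sets lebesgue" and good: "\<And>x. x \<notin> N \<Longrightarrow> riesz_potential \<nu> x \<noteq> \<infinity>"
    "\<And>x. x \<notin> N \<Longrightarrow> x \<in> X \<Longrightarrow>
       f x * (1 + (x - x0)\<^sup>2 * \<kappa> x) = f0 + (x - x0) * f1 + (x - x0)\<^sup>2 * \<phi> x"
    by (elim AE_E3) auto
  have bound: "norm ((x - x0) * \<kappa> x) \<le> s x" "norm ((x - x0) * \<phi> x) \<le> s x" if "x \<notin> N" for x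
    using Cauchy_integral_le_potential(2)[OF X_meas h k_meas kh good(1)[OF that, unfolded \<nu>_def]]
      Cauchy_integral_le_potential(2)[OF X_meas h fk_meas fkh good(1)[OF that, unfolded \<nu>_def]]
    by (auto simp: norm_mult s_def \<kappa>_def \<phi>_def \<nu>_def intro: mult_left_mono)

  define E where "E = X \<inter> S - N"
  have E_meas: "E \<in> sets lebesgue" unfolding E_def
    using X_meas S(2) N by (auto simp: full_area_density_def)
  have "full_area_density E x0"
  proof -
    have "\<forall>\<^sub>F x in at x0 within S. s x < 1" by (rule order_tendstoD(2)[OF s_lim]) simp
    then obtain \<delta> where \<delta>: "0 < \<delta>" "\<And>x. x \<in> S \<Longrightarrow> x \<noteq> x0 \<Longrightarrow> dist x x0 < \<delta> \<Longrightarrow> s x < 1"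
      unfolding eventually_at by auto
    have "ball x0 (min \<delta> 1) \<inter> S - N \<subseteq> E"
    proof
      fix x assume x: "x \<in> ball x0 (min \<delta> 1) \<inter> S - N"
      have "x \<in> X"
      proof (rule ccontr)
        \<comment> \<open>Off \<open>X\<close> the Cauchy transform of \<open>k\<close> equals \<open>-1 / (x - x0)\<^sup>2\<close>, too large for a point of \<open>S\<close>.\<close>
        assume "x \<notin> X"
        then have "x \<noteq> x0" using x0 by auto
        then have s1: "s x < 1" using \<delta>(2)[of x] x by (auto simp: dist_commute)
        have "1 + (x - x0)\<^sup>2 * \<kappa> x = 0"
          unfolding \<kappa>_def by (rule Cauchy_transform_outside[OF X x0 k rep \<open>x \<notin> X\<close>])
        then have "(x - x0) * ((x - x0) * \<kappa> x) = -1"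
          by (simp add: power2_eq_square mult.assoc add_eq_0_iff)
        then have "norm (x - x0) * norm ((x - x0) * \<kappa> x) = 1"
          by (metis norm_minus_cancel norm_mult norm_one)
        moreover have "norm (x - x0) * norm ((x - x0) * \<kappa> x) \<le> 1 * norm ((x - x0) * \<kappa> x)"
          using x by (intro mult_right_mono) (auto simp: dist_norm norm_minus_commute)
        ultimately show False using s1 bound(1)[of x] x by auto
      qed
      then show "x \<in> E" using x by (simp add: E_def)
    qed
    then show ?thesis
      by (rule full_area_density_superset[OF S(2) N E_meas, rotated]) (use \<delta> in auto)
  qed
  moreover have "((\<lambda>x. norm ((f x - f0) / (x - x0) - f1)) \<longlongrightarrow> 0) (at x0 within E)"
  proof -
    let ?F = "at x0 within E"
    have s_E: "(s \<longlongrightarrow> 0) ?F" by (rule tendsto_within_subset[OF s_lim]) (auto simp: E_def)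
    have in_E: "\<forall>\<^sub>F x in ?F. x \<in> E \<and> x \<noteq> x0" by (auto simp: eventually_at intro: exI[of _ 1])
    have \<kappa>0: "((\<lambda>x. (x - x0) * \<kappa> x) \<longlongrightarrow> 0) ?F"
      by (rule Lim_null_comparison[OF _ s_E], use in_E in eventually_elim) (auto simp: E_def intro: bound)
    have \<phi>0: "((\<lambda>x. (x - x0) * \<phi> x) \<longlongrightarrow> 0) ?F"
      by (rule Lim_null_comparison[OF _ s_E], use in_E in eventually_elim) (auto simp: E_def intro: bound)
    have d0: "((\<lambda>x. x - x0) \<longlongrightarrow> 0) ?F"
      by (rule LIM_zero) (rule tendsto_ident_at)
    define D where "D x = 1 + (x - x0) * ((x - x0) * \<kappa> x)" for x
    have D1: "(D \<longlongrightarrow> 1) ?F"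
      unfolding D_def using tendsto_add[OF tendsto_const[of 1] tendsto_mult[OF d0 \<kappa>0]] by simp
    have "((\<lambda>x. (f1 + (x - x0) * \<phi> x - (x - x0) * \<kappa> x * f0) / D x) \<longlongrightarrow> (f1 + 0 - 0 * f0) / 1) ?F"
      by (intro tendsto_divide tendsto_diff tendsto_add tendsto_const tendsto_mult_right \<phi>0 \<kappa>0 D1) simp
    moreover have "\<forall>\<^sub>F x in ?F. D x \<noteq> 0"
      by (rule tendsto_imp_eventually_ne[OF D1]) simp
    with in_E have "\<forall>\<^sub>F x in ?F. (f1 + (x - x0) * \<phi> x - (x - x0) * \<kappa> x * f0) / D x = (f x - f0) / (x - x0)"
    proof eventually_elim
      case (elim x)
      have "f x * D x = f0 + (x - x0) * f1 + (x - x0)\<^sup>2 * \<phi> x"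
        using good(2)[of x] elim by (simp add: E_def D_def power2_eq_square mult.assoc)
      then have "(f x - f0) * D x = (x - x0) * (f1 + (x - x0) * \<phi> x - (x - x0) * \<kappa> x * f0)"
        unfolding D_def by (simp add: algebra_simps power2_eq_square)
      then show ?case using elim by (simp add: field_simps)
    qed
    ultimately have "((\<lambda>x. (f x - f0) / (x - x0)) \<longlongrightarrow> (f1 + 0 - 0 * f0) / 1) ?F"
      by (rule Lim_transform_eventually)
    then have "((\<lambda>x. (f x - f0) / (x - x0)) \<longlongrightarrow> f1) ?F" by simp
    then show ?thesis by (intro tendsto_norm_zero LIM_zero)
  qed
  moreover have "E \<subseteq> X" by (auto simp: E_def)
  ultimately show ?thesis unfolding f0_def f1_def by blast
qed

end
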